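(* Let $\nu$ be a compactly supported Borel probability measure on $\mathbb{R}^d$. The following regularity implications hold for $r>0$: \[ \nu\text{ is }L^{q}\text{-regular for }r\ \Longrightarrow\ \nu\text{ is }r\text{-MF-regular}\ \Longrightarrow\ \underline{D}_{r}(\nu)=\overline{D}_{r}(\nu)=\overline{\mathfrak{R}}_{\nu}(q_{r}). \]
   Context: Let $\Lambda$ be Lebesgue measure on $\mathbb{R}^d$ and $\|\cdot\|$ the Euclidean norm. For $n\in\mathbb{N}$ let $\mathcal{D}_n$ be the partition of $\mathbb{R}^d$ into half-open cubes $\prod_{i=1}^d(k_i2^{-n},(k_i+1)2^{-n}]$, $k\in\mathbb{Z}^d$. Quantization dimensions: for $r>0$ let $\mathfrak{e}_{n,r}(\nu)=\inf\left\{\left(\int d(x,\alpha)^r\,d\nu(x)\right)^{1/r}:\alpha\subset\mathbb{R}^d,\ 1\le\mathrm{card}(\alpha)\le n\right\}$ with $d(x,\alpha)=\min_{y\in\alpha}\|x-y\|$; $\overline{D}_r(\nu)=\limsup_{n\to\infty}\frac{\log n}{-\log\mathfrak{e}_{n,r}(\nu)}$ and $\underline{D}_r(\nu)=\liminf_{n\to\infty}\frac{\log n}{-\log\mathfrak{e}_{n,r}(\nu)}$. $L^q$-spectrum: for $q\ge0$, $\beta_{\nu}(q)=\limsup_{n\to\infty}\beta_{\nu,n}(q)$ with $\beta_{\nu,n}(q)=\frac{\log\left(\sum_{C\in\mathcal{D}_n}\nu(C)^q\right)}{\log(2^n)}$ (with $0^0=0$). For $r>0$, $q_r=\inf\{q>0:\beta_\nu(q)<rq\}$.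 The (upper) generalized Rényi dimension is, for $q\ge0$, $\overline{\mathfrak{R}}_\nu(q)=\beta_\nu(q)/(1-q)$ if $q\ne1$, and $\overline{\mathfrak{R}}_\nu(1)=\limsup_n\left(\sum_{C\in\mathcal{D}_n}\nu(C)\log\nu(C)\right)/\log(2^{-n})$. Coarse multifractal dimensions: for $\alpha>0$, $\mathcal{N}_{\nu,\alpha,r}(n)=\mathrm{card}\{Q\in\mathcal{D}_n:\nu(Q)\Lambda(Q)^{r/d}\ge2^{-\alpha n}\}$; $\overline{F}_{\nu,r}(\alpha)=\limsup_n\frac{\log^+(\mathcal{N}_{\nu,\alpha,r}(n))}{\log2^n}$ and $\underline{F}_{\nu,r}(\alpha)=\liminf_n\frac{\log^+(\mathcal{N}_{\nu,\alpha,r}(n))}{\log2^n}$, where $\log^+(y)=\max\{\log y,0\}$ and $\log^+(0)=0$; $\overline{F}_{\nu,r}=\sup_{\alpha>0}\overline{F}_{\nu,r}(\alpha)/\alpha$ and $\underline{F}_{\nu,r}=\sup_{\alpha>0}\underline{F}_{\nu,r}(\alpha)/\alpha$. Regularity: $\nu$ is multifractal-regular in $r$ ($r$-MF-regular) if $\underline{F}_{\nu,r}=\overline{F}_{\nu,r}$. $\nu$ is $L^q$-regular for $r$ if (a) $\beta_\nu(q)=\liminf_n\beta_{\nu,n}(q)\in\mathbb{R}$ for all $q\in(q_r-\varepsilon,q_r)$, for some $\varepsilon>0$, or (b) $\beta_\nu(q_r)=\liminf_n\beta_{\nu,n}(q_r)$ and $\beta_\nu$ is differentiable in $q_r$.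
   Formalization: The final equality with the Rényi dimension at q_r is stated only when q_r > 0 or β_ν(0) = 0: if q_r = 0 and β_ν(0) > 0, both quantization dimensions are 0 while the Rényi dimension at q_r is β_ν(0), so the equality fails (e.g. atoms at 1/k with masses proportional to 2^(-2^k)). *)

theory Defs
  imports "HOL-Probability.Probability"
begin

definition topological_support :: "'a::topological_space measure \<Rightarrow> 'a set" where
  "topological_support \<nu> = {x. \<forall>U. open U \<longrightarrow> x \<in> U \<longrightarrow> emeasure \<nu> U > 0}"

definition dyadic_cubes :: "nat \<Rightarrow> (real^'d) set set" where
  "dyadic_cubes n = range (\<lambda>k :: int^'d.
     {x. \<forall>i. real_of_int (k $ i) / 2 ^ n < x $ i \<and> x $ i \<le> (real_of_int (k $ i) + 1) / 2 ^ n})"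


subsection \<open>Quantization dimensions\<close>

definition quantization_error :: "real \<Rightarrow> (real^'d) measure \<Rightarrow> nat \<Rightarrow> real" where
  "quantization_error r \<nu> n =
     (INF A\<in>{A. finite A \<and> 1 \<le> card A \<and> card A \<le> n}.
        (\<integral>x. infdist x A powr r \<partial>\<nu>) powr (1 / r))"

text \<open>The quotient is read as \<open>0\<close> when the error vanishes, because then \<open>- log 0 = \<infinity>\<close>.\<close>

definition quantization_quotient :: "real \<Rightarrow> (real^'d) measure \<Rightarrow> nat \<Rightarrow> real" where
  "quantization_quotient r \<nu> n =
     (if quantization_error r \<nu> n = 0 then 0
      else ln (real n) / (- ln (quantization_error r \<nu> n)))"

definition upper_quantization_dim :: "real \<Rightarrow> (real^'d) measure \<Rightarrow> ereal" where
  "upper_quantization_dim r \<nu> = limsup (\<lambda>n. ereal (quantization_quotient r \<nu> n))"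

definition lower_quantization_dim :: "real \<Rightarrow> (real^'d) measure \<Rightarrow> ereal" where
  "lower_quantization_dim r \<nu> = liminf (\<lambda>n. ereal (quantization_quotient r \<nu> n))"


subsection \<open>The \<open>L\<^sup>q\<close>-spectrum and generalized Renyi dimensions\<close>

text \<open>In the library \<open>0 powr q = 0\<close> for every \<open>q\<close>, including \<open>q = 0\<close>, and \<open>0 * ln 0 = 0\<close>. For
  compactly supported measures only finitely many summands are nonzero.\<close>

definition Lq_spectrum_at :: "(real^'d) measure \<Rightarrow> nat \<Rightarrow> real \<Rightarrow> real" where
  "Lq_spectrum_at \<nu> n q = ln (\<Sum>\<^sub>\<infinity>C\<in>dyadic_cubes n. measure \<nu> C powr q) / ln (2 ^ n)"

definition Lq_spectrum :: "(real^'d) measure \<Rightarrow> real \<Rightarrow> ereal" where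
  "Lq_spectrum \<nu> q = limsup (\<lambda>n. ereal (Lq_spectrum_at \<nu> n q))"

definition lower_Lq_spectrum :: "(real^'d) measure \<Rightarrow> real \<Rightarrow> ereal" where
  "lower_Lq_spectrum \<nu> q = liminf (\<lambda>n. ereal (Lq_spectrum_at \<nu> n q))"

definition critical_q :: "(real^'d) measure \<Rightarrow> real \<Rightarrow> real" where
  "critical_q \<nu> r = Inf {q. q > 0 \<and> Lq_spectrum \<nu> q < ereal (r * q)}"

text \<open>At \<open>q = 0\<close> the sum counts the cubes of positive mass, so \<open>Lq_spectrum \<nu> 0\<close> is the upper
  box dimension of the support; the spectrum may jump there. For \<open>\<nu> = (\<Sum>k. p\<^sub>k \<delta>\<^bsub>1/k\<^esub>)\<close> with
  weights \<open>p\<^sub>k\<close> proportional to \<open>2 powr (- (2 ^ k))\<close> it vanishes for \<open>0 < q \<le> 1\<close> but equals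
  \<open>1 / 2\<close> at \<open>0\<close>; then \<open>critical_q \<nu> r = 0\<close> and both quantization dimensions are \<open>0\<close>, whereas
  \<open>upper_Renyi_dim \<nu> 0 = 1 / 2\<close>.\<close>

definition upper_Renyi_dim :: "(real^'d) measure \<Rightarrow> real \<Rightarrow> ereal" where
  "upper_Renyi_dim \<nu> q =
     (if q = 1
      then limsup (\<lambda>n. ereal ((\<Sum>\<^sub>\<infinity>C\<in>dyadic_cubes n. measure \<nu> C * ln (measure \<nu> C))
                              / ln (1 / 2 ^ n)))
      else Lq_spectrum \<nu> q / ereal (1 - q))"


subsection \<open>Coarse multifractal dimensions\<close>

definition coarse_count :: "real \<Rightarrow> (real^'d) measure \<Rightarrow> real \<Rightarrow> nat \<Rightarrow> nat" where
  "coarse_count r \<nu> \<alpha> n =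
     card {Q \<in> dyadic_cubes n.
             measure \<nu> Q * measure lborel Q powr (r / real CARD('d)) \<ge> 2 powr (- \<alpha> * real n)}"

definition log_plus :: "real \<Rightarrow> real" where
  "log_plus y = (if y = 0 then 0 else max (ln y) 0)"

definition upper_coarse_dim_at :: "real \<Rightarrow> (real^'d) measure \<Rightarrow> real \<Rightarrow> ereal" where
  "upper_coarse_dim_at r \<nu> \<alpha> =
     limsup (\<lambda>n. ereal (log_plus (real (coarse_count r \<nu> \<alpha> n)) / ln (2 ^ n)))"

definition lower_coarse_dim_at :: "real \<Rightarrow> (real^'d) measure \<Rightarrow> real \<Rightarrow> ereal" where
  "lower_coarse_dim_at r \<nu> \<alpha> =
     liminf (\<lambda>n. ereal (log_plus (real (coarse_count r \<nu> \<alpha> n)) / ln (2 ^ n)))"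

definition upper_coarse_dim :: "real \<Rightarrow> (real^'d) measure \<Rightarrow> ereal" where
  "upper_coarse_dim r \<nu> = (SUP \<alpha>\<in>{0<..}. upper_coarse_dim_at r \<nu> \<alpha> / ereal \<alpha>)"

definition lower_coarse_dim :: "real \<Rightarrow> (real^'d) measure \<Rightarrow> ereal" where
  "lower_coarse_dim r \<nu> = (SUP \<alpha>\<in>{0<..}. lower_coarse_dim_at r \<nu> \<alpha> / ereal \<alpha>)"


subsection \<open>Regularity\<close>

definition MF_regular :: "real \<Rightarrow> (real^'d) measure \<Rightarrow> bool" where
  "MF_regular r \<nu> \<longleftrightarrow> lower_coarse_dim r \<nu> = upper_coarse_dim r \<nu>"

text \<open>The spectrum lives on \<open>{0..}\<close>. Hence in the first alternative \<open>q\<close> is restricted to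
  \<open>q \<ge> 0\<close>, and in the second one differentiability is taken within \<open>{0..}\<close>; both matter only if
  the critical exponent is \<open>0\<close>. For compactly supported probability measures the spectrum is
  finite, so that passing to the reals does not change it.\<close>

definition Lq_regular :: "real \<Rightarrow> (real^'d) measure \<Rightarrow> bool" where
  "Lq_regular r \<nu> \<longleftrightarrow>
     (\<exists>\<epsilon>>0. \<forall>q\<in>{critical_q \<nu> r - \<epsilon> <..< critical_q \<nu> r}. 0 \<le> q \<longrightarrow>
        Lq_spectrum \<nu> q = lower_Lq_spectrum \<nu> q \<and> \<bar>Lq_spectrum \<nu> q\<bar> \<noteq> \<infinity>)
     \<or> (Lq_spectrum \<nu> (critical_q \<nu> r) = lower_Lq_spectrum \<nu> (critical_q \<nu> r)
        \<and> (\<lambda>q. real_of_ereal (Lq_spectrum \<nu> q)) differentiable (at (critical_q \<nu> r) within {0..}))"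

end

theory Submission
  imports Defs
begin

text \<open>
  Write \<open>\<beta>\<close> for the spectrum and \<open>q\<^sub>r\<close> for the critical exponent. Interpolating with
  the number of charged cubes gives \<open>\<beta> ((1 - \<theta>) * q) \<le> \<theta> * d + (1 - \<theta>) * \<beta> q\<close>, hence
  \<open>q\<^sub>r < 1\<close>, and \<open>\<beta> q\<^sub>r = r * q\<^sub>r\<close> if \<open>q\<^sub>r > 0\<close>. Comparing the partition sums
  with the coarse counts, threshold by threshold, shows that the upper coarse dimension is always
  \<open>q\<^sub>r\<close>. Regularity of the spectrum bounds the lower coarse dimension from below by a large
  deviation argument at a point where \<open>\<beta>\<close> is nearly linear; in the first alternative such a point
  near \<open>q\<^sub>r\<close> exists because \<open>\<beta>\<close> is bounded and monotone.

  For the quantization error, choose one point in each charged unit cube and in each cube \<open>C\<close> of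
  side \<open>2 powr (- n)\<close> with \<open>\<nu> C * 2 powr (- r * n) \<ge> t\<close>. If \<open>\<beta> q < r * q\<close>, these are \<open>O (t powr (- q))\<close> points
  with an error integral \<open>O (t powr (1 - q))\<close>, so the upper quantization dimension is at most
  \<open>r * q\<^sub>r / (1 - q\<^sub>r)\<close>. Conversely, a point is near only boundedly many cubes of a given
  level, so the cubes of a coarse count that are far from a small set bound its error integral
  below, and the lower quantization dimension is at least \<open>r * F / (1 - F)\<close>, where \<open>F\<close> is the
  lower coarse dimension.
\<close>

subsection \<open>Dyadic cubes\<close>

definition dyadic_cube :: "nat \<Rightarrow> int^'d \<Rightarrow> (real^'d) set" where
  "dyadic_cube n k =
     {x. \<forall>i. real_of_int (k $ i) / 2 ^ n < x $ i \<and> x $ i \<le> (real_of_int (k $ i) + 1) / 2 ^ n}"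

text \<open>The cubes are open on the left and closed on the right, hence a ceiling minus one rather
  than a floor.\<close>

definition dyadic_index :: "nat \<Rightarrow> real^'d \<Rightarrow> int^'d" where
  "dyadic_index n x = (\<chi> i. \<lceil>x $ i * 2 ^ n\<rceil> - 1)"

lemma dyadic_cubes_eq: "dyadic_cubes n = range (dyadic_cube n)"
  by (simp add: dyadic_cubes_def dyadic_cube_def)

text \<open>Membership becomes an equation between indices, which gives existence and uniqueness of
  the cube of level \<open>n\<close> around a point.\<close>

lemma mem_dyadic_cube_iff: "x \<in> dyadic_cube n k \<longleftrightarrow> dyadic_index n x = k"
proof -
  have "real_of_int j / 2 ^ n < y \<and> y \<le> (real_of_int j + 1) / 2 ^ n \<longleftrightarrow> \<lceil>y * 2 ^ n\<rceil> - 1 = j"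
    for j y
  proof -
    have "\<lceil>y * 2 ^ n\<rceil> - 1 = j \<longleftrightarrow> \<lceil>y * 2 ^ n\<rceil> = j + 1" by linarith
    also have "\<dots> \<longleftrightarrow> real_of_int j < y * 2 ^ n \<and> y * 2 ^ n \<le> real_of_int j + 1"
      by (subst ceiling_eq_iff) auto
    finally show ?thesis
      by (simp add: pos_divide_less_eq pos_le_divide_eq)
  qed
  then show ?thesis
    by (auto simp: dyadic_cube_def dyadic_index_def vec_eq_iff)
qed

lemma dyadic_cubes_unique:
  "C \<in> dyadic_cubes n \<Longrightarrow> x \<in> C \<Longrightarrow> C = dyadic_cube n (dyadic_index n x)"
  by (auto simp: dyadic_cubes_eq mem_dyadic_cube_iff)

lemma disjoint_dyadic_cubes: "disjoint (dyadic_cubes n)"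
  by (auto simp: disjoint_def dest: dyadic_cubes_unique)

lemma dyadic_cubes_borel [measurable]:
  assumes "C \<in> dyadic_cubes n" shows "C \<in> sets (borel :: (real^'d) measure)"
proof -
  obtain k where C: "C = dyadic_cube n k" using assms by (auto simp: dyadic_cubes_eq)
  have "{x :: real^'d. \<forall>i. real_of_int (k $ i) / 2 ^ n < x $ i \<and> x $ i \<le> (real_of_int (k $ i) + 1) / 2 ^ n}
      \<in> sets borel" by measurable
  then show ?thesis by (simp add: C dyadic_cube_def)
qed

text \<open>The half-open cube lies between the open and the closed box with the same corners, and
  these have equal volume.\<close>

lemma measure_lborel_dyadic_cube:
  assumes "C \<in> dyadic_cubes n"
  shows "measure lborel (C :: (real^'d) set) = (1 / 2 ^ n) ^ CARD('d)"
proof -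
  obtain k where C: "C = dyadic_cube n k" using assms by (auto simp: dyadic_cubes_eq)
  define a b :: "real^'d" where "a = (\<chi> i. real_of_int (k $ i) / 2 ^ n)"
    and "b = (\<chi> i. (real_of_int (k $ i) + 1) / 2 ^ n)"
  have le: "a $ i \<le> b $ i" for i by (simp add: a_def b_def divide_right_mono)
  have ne: "cbox a b \<noteq> {}" using le by (simp add: interval_ne_empty_cart)
  have c: "measure lborel (cbox a b) = (1 / 2 ^ n) ^ CARD('d)"
    using ne by (simp add: content_cbox_cart a_def b_def diff_divide_distrib[symmetric])
  have e: "measure lborel (box a b) = measure lborel (cbox a b)"
    by (simp add: measure_lborel_box_eq measure_lborel_cbox_eq)
  have sub: "box a b \<subseteq> C" "C \<subseteq> cbox a b"
    by (auto simp: C dyadic_cube_def a_def b_def mem_box_cart less_imp_le)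
  have "measure lborel (box a b) \<le> measure lborel C"
    by (rule measure_mono_fmeasurable)
       (use sub dyadic_cubes_borel[OF assms] in \<open>auto intro: fmeasurableI2[OF fmeasurable_cbox]\<close>)
  moreover have "measure lborel C \<le> measure lborel (cbox a b)"
    by (rule measure_mono_fmeasurable)
       (use sub dyadic_cubes_borel[OF assms] in auto)
  ultimately show ?thesis using c e by simp
qed

text \<open>The norm is bounded by the sum of the absolute coordinates; the cruder constant
  \<open>CARD('d)\<close> instead of its square root does not affect any dimension.\<close>

lemma dist_dyadic_cube_le:
  assumes "C \<in> dyadic_cubes n" "x \<in> C" "y \<in> C"
  shows "dist x (y :: real^'d) \<le> real CARD('d) / 2 ^ n"
proof -
  obtain k where C: "C = dyadic_cube n k" using assms by (auto simp: dyadic_cubes_eq)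
  have "\<bar>(x - y) $ i\<bar> \<le> 1 / 2 ^ n" for i
  proof -
    have "real_of_int (k $ i) / 2 ^ n < x $ i" "x $ i \<le> real_of_int (k $ i) / 2 ^ n + 1 / 2 ^ n"
      "real_of_int (k $ i) / 2 ^ n < y $ i" "y $ i \<le> real_of_int (k $ i) / 2 ^ n + 1 / 2 ^ n"
      using assms(2,3) by (auto simp: C dyadic_cube_def add_divide_distrib)
    then show ?thesis by (simp add: abs_le_iff)
  qed
  then have "(\<Sum>i\<in>UNIV. \<bar>(x - y) $ i\<bar>) \<le> (\<Sum>i\<in>(UNIV::'d set). 1 / 2 ^ n)"
    by (intro sum_mono) auto
  with norm_le_l1_cart[of "x - y"] show ?thesis by (simp add: dist_norm)
qed

lemma int_box_finite_card:
  fixes l :: "int^'d"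
  shows "finite {k. \<forall>i. l $ i \<le> k $ i \<and> k $ i < l $ i + int m}" (is "finite ?K")
    and "card {k. \<forall>i. l $ i \<le> k $ i \<and> k $ i < l $ i + int m} \<le> m ^ CARD('d)"
proof -
  define P where "P = PiE UNIV (\<lambda>i. {l $ i..<l $ i + int m})"
  have fin: "finite P" unfolding P_def by (intro finite_PiE) auto
  have sub: "?K \<subseteq> vec_lambda ` P"
  proof
    fix k assume "k \<in> ?K"
    then have "vec_nth k \<in> P" by (auto simp: P_def)
    then show "k \<in> vec_lambda ` P" by (metis image_eqI vec_lambda_eta)
  qed
  have "card P = m ^ CARD('d)" unfolding P_def by (subst card_PiE) auto
  then show "finite ?K" "card ?K \<le> m ^ CARD('d)"
    using sub fin card_image_le[OF fin, of vec_lambda] card_mono[OF finite_imageI[OF fin] sub]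
    by (auto intro: finite_subset)
qed

text \<open>The bound does not depend on the level \<open>n\<close>. This is what limits how many
  cubes a single point of a quantizer can serve.\<close>

lemma dyadic_cubes_near_point:
  fixes y :: "real^'d" and n :: nat
  defines "K \<equiv> {C \<in> dyadic_cubes n. \<exists>x\<in>C. dist x y < 1 / 2 ^ n}"
  shows "finite K" and "card K \<le> 4 ^ CARD('d)"
proof -
  \<comment> \<open>A coordinate of a near index lies between \<open>y $ i * 2 ^ n - 2\<close> and
    \<open>y $ i * 2 ^ n + 1\<close>, hence among the four integers starting here.\<close>
  define l :: "int^'d" where "l = (\<chi> i. \<lfloor>y $ i * 2 ^ n\<rfloor> - 2)"
  let ?B = "{k. \<forall>i. l $ i \<le> k $ i \<and> k $ i < l $ i + int 4}"
  have sub: "K \<subseteq> dyadic_cube n ` ?B"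
  proof
    fix C assume "C \<in> K"
    then obtain k x where k: "C = dyadic_cube n k" and x: "x \<in> C" "dist x y < 1 / 2 ^ n"
      by (auto simp: K_def dyadic_cubes_eq)
    have "l $ i \<le> k $ i \<and> k $ i < l $ i + 4" for i
    proof -
      have "\<bar>x $ i - y $ i\<bar> < 1 / 2 ^ n"
        using component_le_norm_cart[of "x - y" i] x(2) by (simp add: dist_norm)
      then have "\<bar>x $ i - y $ i\<bar> * 2 ^ n < 1" by (simp add: pos_less_divide_eq)
      then have "\<bar>x $ i * 2 ^ n - y $ i * 2 ^ n\<bar> < 1"
        by (metis abs_mult abs_numeral left_diff_distrib power_abs)
      moreover have "real_of_int (k $ i) < x $ i * 2 ^ n" "x $ i * 2 ^ n \<le> real_of_int (k $ i) + 1"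
        using x(1) by (auto simp: k dyadic_cube_def pos_divide_less_eq pos_le_divide_eq)
      ultimately show ?thesis unfolding l_def by simp linarith
    qed
    then show "C \<in> dyadic_cube n ` ?B" by (auto simp: k)
  qed
  show "finite K" using sub int_box_finite_card(1)[of l 4] finite_subset by blast
  have "card K \<le> card (dyadic_cube n ` ?B)"
    by (intro card_mono finite_imageI int_box_finite_card sub)
  also have "\<dots> \<le> card ?B" by (intro card_image_le int_box_finite_card)
  also have "\<dots> \<le> 4 ^ CARD('d)" by (rule int_box_finite_card)
  finally show "card K \<le> 4 ^ CARD('d)" .
qed

text \<open>Every point off the support has a null open neighbourhood; by the Lindelof property
  countably many of these cover the complement.\<close>

lemma emeasure_compl_topological_support:
  fixes \<nu> :: "'a::second_countable_topology measure"
  assumes sets: "sets \<nu> = sets borel"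
  shows "emeasure \<nu> (- topological_support \<nu>) = 0"
proof -
  define F where "F = {U. open U \<and> emeasure \<nu> U = 0}"
  have eq: "- topological_support \<nu> = \<Union>F"
    by (auto simp: topological_support_def F_def zero_less_iff_neq_zero)
  obtain F' where F': "F' \<subseteq> F" "countable F'" "\<Union>F' = \<Union>F"
    using Lindelof[of F] by (auto simp: F_def)
  have "(\<Union>U\<in>F'. U) \<in> null_sets \<nu>"
    using F' by (intro null_sets_UN') (auto simp: F_def null_sets_def sets)
  then show ?thesis using eq F'(3) by (simp add: null_sets_def)
qed

section \<open>Charged cubes of a compactly supported probability measure\<close>

locale compactly_supported_prob = prob_space \<nu> for \<nu> :: "(real^'d) measure" +
  assumes sets_eq [simp, measurable_cong]: "sets \<nu> = sets borel"
    and compact_support: "compact (topological_support \<nu>)"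
begin

lemma space_eq [simp]: "space \<nu> = UNIV"
  using sets_eq_imp_space_eq[OF sets_eq] by simp

text \<open>A natural number, so that \<open>radius * 2 ^ n\<close> can be compared directly with
  integer indices.\<close>

definition radius :: nat where
  "radius = (SOME R. topological_support \<nu> \<subseteq> cball 0 (real R))"

lemma support_subset: "topological_support \<nu> \<subseteq> cball 0 (real radius)"
proof -
  obtain B where "\<forall>x\<in>topological_support \<nu>. norm x \<le> B"
    using compact_imp_bounded[OF compact_support] by (auto simp: bounded_iff)
  then have "topological_support \<nu> \<subseteq> cball 0 B" by auto
  then have "topological_support \<nu> \<subseteq> cball 0 (real (nat \<lceil>B\<rceil>))"
    using subset_cball[of B "real (nat \<lceil>B\<rceil>)" 0] by (meson order_trans real_nat_ceiling_ge)
  then show ?thesis unfolding radius_def by (rule someI)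
qed

lemma AE_bounded: "AE x in \<nu>. norm x \<le> real radius"
proof (rule AE_I)
  show "{x \<in> space \<nu>. \<not> norm x \<le> real radius} \<subseteq> - topological_support \<nu>"
    using support_subset by auto
  show "emeasure \<nu> (- topological_support \<nu>) = 0"
    by (rule emeasure_compl_topological_support) simp
  show "- topological_support \<nu> \<in> sets \<nu>"
    using compact_imp_closed[OF compact_support] by (simp add: borel_comp)
qed

text \<open>The finite family to which all sums over \<open>dyadic_cubes n\<close> reduce; on it
  powers and logarithms of masses are well behaved.\<close>

definition pos_cubes :: "nat \<Rightarrow> (real^'d) set set" where
  "pos_cubes n = {C \<in> dyadic_cubes n. prob C > 0}"

lemma pos_cubesD: "C \<in> pos_cubes n \<Longrightarrow> C \<in> dyadic_cubes n" "C \<in> pos_cubes n \<Longrightarrow> prob C > 0"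
  by (auto simp: pos_cubes_def)

lemma pos_cubes_sets [measurable]: "C \<in> pos_cubes n \<Longrightarrow> C \<in> sets borel"
  by (auto dest: pos_cubesD)

definition cube_const :: nat where "cube_const = (2 * radius + 2) ^ CARD('d)"

lemma cube_const_pos: "cube_const > 0"
  by (simp add: cube_const_def)

text \<open>A charged cube meets the ball of radius \<open>radius\<close>, since otherwise it would
  be null; this confines its index to an integer box.\<close>

lemma pos_cubes_finite: "finite (pos_cubes n)"
  and card_pos_cubes_le: "real (card (pos_cubes n)) \<le> real cube_const * 2 ^ (CARD('d) * n)"
proof -
  \<comment> \<open>A coordinate in \<open>[- radius, radius]\<close> gives
    \<open>- radius * 2 ^ n - 1 \<le> k\<close> and \<open>k < radius * 2 ^ n\<close>. The extra
    \<open>1\<close> fits into the side \<open>m\<close> because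
    \<open>1 \<le> 2 ^ n\<close>.\<close>
  define l :: "int^'d" where "l = (\<chi> i. - int radius * 2 ^ n - 1)"
  define m where "m = (2 * radius + 2) * 2 ^ n"
  let ?B = "{k. \<forall>i. l $ i \<le> k $ i \<and> k $ i < l $ i + int m}"
  have sub: "pos_cubes n \<subseteq> dyadic_cube n ` ?B"
  proof
    fix C assume C: "C \<in> pos_cubes n"
    have "\<exists>x\<in>C. norm x \<le> real radius"
    proof (rule ccontr)
      assume "\<not> ?thesis"
      then have "AE x in \<nu>. x \<notin> C" using AE_bounded by auto
      then have "prob C = 0"
        using pos_cubes_sets[OF C] by (subst prob_eq_0) auto
      then show False using pos_cubesD[OF C] by simp
    qed
    then obtain x where x: "x \<in> C" "norm x \<le> real radius" by blast
    obtain k where k: "C = dyadic_cube n k" using pos_cubesD(1)[OF C] by (auto simp: dyadic_cubes_eq)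
    have "l $ i \<le> k $ i \<and> k $ i < l $ i + int m" for i
    proof -
      have "\<bar>x $ i\<bar> \<le> real radius" using component_le_norm_cart[of x i] x(2) by linarith
      then have "\<bar>x $ i * 2 ^ n\<bar> \<le> real radius * 2 ^ n"
        by (simp add: abs_mult)
      moreover have "real_of_int (k $ i) < x $ i * 2 ^ n" "x $ i * 2 ^ n \<le> real_of_int (k $ i) + 1"
        using x(1) by (auto simp: k dyadic_cube_def pos_divide_less_eq pos_le_divide_eq)
      ultimately have "real_of_int (k $ i) < real_of_int (int radius * 2 ^ n)"
        "real_of_int (- int radius * 2 ^ n) \<le> real_of_int (k $ i + 1)"
        by auto
      then have "k $ i < int radius * 2 ^ n" "- int radius * 2 ^ n \<le> k $ i + 1"
        by (simp_all only: of_int_less_iff of_int_le_iff)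
      moreover have "(1::int) \<le> 2 ^ n" by simp
      ultimately have "- int radius * 2 ^ n - 1 \<le> k $ i"
        "k $ i < - int radius * 2 ^ n - 1 + (2 * int radius + 2) * 2 ^ n"
        unfolding distrib_right by linarith+
      then show ?thesis by (simp add: l_def m_def algebra_simps)
    qed
    then show "C \<in> dyadic_cube n ` ?B" by (auto simp: k)
  qed
  show "finite (pos_cubes n)" using sub int_box_finite_card(1)[of l m] finite_subset by blast
  have "card (pos_cubes n) \<le> card (dyadic_cube n ` ?B)"
    by (intro card_mono finite_imageI int_box_finite_card sub)
  also have "\<dots> \<le> card ?B" by (intro card_image_le int_box_finite_card)
  also have "\<dots> \<le> m ^ CARD('d)" by (rule int_box_finite_card)
  also have "\<dots> = cube_const * 2 ^ (CARD('d) * n)"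
    unfolding m_def cube_const_def power_mult_distrib mult.commute[of "CARD('d)" n]
    by (simp only: power_mult)
  finally show "real (card (pos_cubes n)) \<le> real cube_const * 2 ^ (CARD('d) * n)"
    by (metis of_nat_le_iff of_nat_mult of_nat_numeral of_nat_power)
qed

text \<open>At each level there are only countably many cubes, so the uncharged ones form a null
  set; there are countably many levels.\<close>

lemma AE_in_pos_cubes: "AE x in \<nu>. \<forall>n. dyadic_cube n (dyadic_index n x) \<in> pos_cubes n"
proof (subst AE_all_countable, rule allI)
  fix n
  have "countable (dyadic_cubes n - pos_cubes n)"
    by (rule countable_subset[of _ "range (dyadic_cube n)"]) (auto simp: dyadic_cubes_eq)
  then have "(\<Union>C\<in>dyadic_cubes n - pos_cubes n. C) \<in> null_sets \<nu>"
    by (rule null_sets_UN')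
       (auto simp: null_sets_def pos_cubes_def emeasure_eq_measure not_less
          intro!: dyadic_cubes_borel antisym[OF _ measure_nonneg])
  then show "AE x in \<nu>. dyadic_cube n (dyadic_index n x) \<in> pos_cubes n"
  proof (rule AE_I', intro subsetI)
    fix x assume "x \<in> {x \<in> space \<nu>. dyadic_cube n (dyadic_index n x) \<notin> pos_cubes n}"
    then show "x \<in> (\<Union>C\<in>dyadic_cubes n - pos_cubes n. C)"
      by (intro UN_I[of "dyadic_cube n (dyadic_index n x)"])
         (auto simp: dyadic_cubes_eq mem_dyadic_cube_iff)
  qed
qed

lemma sum_prob_pos_cubes: "(\<Sum>C\<in>pos_cubes n. prob C) = 1"
proof -
  have "disjoint (pos_cubes n)"
    using disjoint_dyadic_cubes[of n] by (auto simp: disjoint_def pos_cubes_def)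
  then have "prob (\<Union>C\<in>pos_cubes n. C) = (\<Sum>C\<in>pos_cubes n. prob C)"
    by (intro finite_measure_finite_Union pos_cubes_finite)
       (auto simp: disjoint_family_on_def disjoint_def)
  moreover have "prob (\<Union>C\<in>pos_cubes n. C) = 1"
  proof (subst prob_eq_1)
    show "(\<Union>C\<in>pos_cubes n. C) \<in> events"
      using pos_cubes_finite by (intro sets.finite_UN) auto
    show "AE x in \<nu>. x \<in> (\<Union>C\<in>pos_cubes n. C)"
      using AE_in_pos_cubes by eventually_elim (use mem_dyadic_cube_iff in blast)
  qed
  ultimately show ?thesis by simp
qed

end

subsection \<open>Partition sums and the spectrum\<close>

text \<open>Dictionary between exponential bounds and normalised logarithms. The factor
  \<open>c\<close> becomes \<open>ln c / ln (2 ^ n)\<close>, which tends to \<open>0\<close>, so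
  constant factors never change a growth rate.\<close>

lemma ln_growth_eq:
  fixes a c s :: real and n :: nat
  assumes "a > 0" "n > 0" "c > 0"
  shows "a \<le> c * 2 powr (real n * s) \<longleftrightarrow> ln a / ln (2 ^ n) \<le> ln c / ln (2 ^ n) + s"
    and "c * 2 powr (real n * s) \<le> a \<longleftrightarrow> ln c / ln (2 ^ n) + s \<le> ln a / ln (2 ^ n)"
proof -
  have ln: "ln (c * 2 powr (real n * s)) = ln c + real n * s * ln 2"
    using assms by (simp add: ln_mult ln_powr)
  have pos: "real n * ln 2 > 0" "c * 2 powr (real n * s) > 0" using assms by simp_all
  have eq: "ln c / ln (2 ^ n) + s = (ln c + real n * s * ln 2) / (real n * ln 2)"
    using assms by (simp add: ln_realpow add_divide_distrib)
  have "a \<le> c * 2 powr (real n * s) \<longleftrightarrow> ln a \<le> ln c + real n * s * ln 2"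
    using ln_le_cancel_iff[OF assms(1) pos(2)] by (simp add: ln)
  then show "a \<le> c * 2 powr (real n * s) \<longleftrightarrow> ln a / ln (2 ^ n) \<le> ln c / ln (2 ^ n) + s"
    unfolding eq using pos(1) by (simp add: ln_realpow divide_le_cancel)
  have "c * 2 powr (real n * s) \<le> a \<longleftrightarrow> ln c + real n * s * ln 2 \<le> ln a"
    using ln_le_cancel_iff[OF pos(2) assms(1)] by (simp add: ln)
  then show "c * 2 powr (real n * s) \<le> a \<longleftrightarrow> ln c / ln (2 ^ n) + s \<le> ln a / ln (2 ^ n)"
    unfolding eq using pos(1) by (simp add: ln_realpow divide_le_cancel)
qed

lemma const_div_ln_growth: "((\<lambda>n. ereal (c / ln (2 ^ n) + s)) \<longlongrightarrow> ereal s) sequentially"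
proof -
  have "(\<lambda>n. c / ln 2 * inverse (real n) + s) \<longlonglongrightarrow> c / ln 2 * 0 + s"
    by (intro tendsto_intros lim_inverse_n)
  then show ?thesis by (simp add: ln_realpow field_simps)
qed

lemma limsup_ln_growth_le:
  assumes "c > 0" "\<forall>\<^sub>F n in sequentially. 0 < a n \<and> a n \<le> c * 2 powr (real n * s)"
  shows "limsup (\<lambda>n. ereal (ln (a n) / ln (2 ^ n))) \<le> ereal s"
proof -
  have "limsup (\<lambda>n. ereal (ln (a n) / ln (2 ^ n))) \<le> limsup (\<lambda>n. ereal (ln c / ln (2 ^ n) + s))"
    by (intro Limsup_mono eventually_mono[OF eventually_conj[OF assms(2) eventually_gt_at_top[of 0]]])
       (auto simp: ln_growth_eq(1) assms(1))
  also have "\<dots> = ereal s"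
    by (intro lim_imp_Limsup const_div_ln_growth) simp
  finally show ?thesis .
qed

lemma liminf_ln_growth_ge:
  assumes "c > 0" "\<forall>\<^sub>F n in sequentially. c * 2 powr (real n * s) \<le> a n"
  shows "ereal s \<le> liminf (\<lambda>n. ereal (ln (a n) / ln (2 ^ n)))"
proof -
  have "ereal s = liminf (\<lambda>n. ereal (ln c / ln (2 ^ n) + s))"
    by (intro lim_imp_Liminf[symmetric] const_div_ln_growth) simp
  also have "\<dots> \<le> liminf (\<lambda>n. ereal (ln (a n) / ln (2 ^ n)))"
  proof (intro Liminf_mono eventually_mono[OF eventually_conj[OF assms(2) eventually_gt_at_top[of 0]]])
    fix n assume n: "c * 2 powr (real n * s) \<le> a n \<and> 0 < n"
    have "0 < c * 2 powr (real n * s)" using assms(1) by simp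
    with n have "a n > 0" by linarith
    with n show "ereal (ln c / ln (2 ^ n) + s) \<le> ereal (ln (a n) / ln (2 ^ n))"
      using ln_growth_eq(2)[of "a n" n c s] assms(1) by simp
  qed
  finally show ?thesis .
qed

lemma limsup_ln_growth_lessD:
  assumes "limsup (\<lambda>n. ereal (ln (a n) / ln (2 ^ n))) < ereal s" "\<And>n. a n > 0"
  shows "\<forall>\<^sub>F n in sequentially. a n \<le> 2 powr (real n * s)"
  using Limsup_lessD[OF assms(1)] eventually_gt_at_top[of 0]
proof eventually_elim
  case (elim n)
  then show ?case using ln_growth_eq(1)[of "a n" n 1 s] assms(2) by simp
qed

lemma liminf_ln_growth_lessD:
  assumes "ereal s < liminf (\<lambda>n. ereal (ln (a n) / ln (2 ^ n)))" "\<And>n. a n > 0"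
  shows "\<forall>\<^sub>F n in sequentially. 2 powr (real n * s) \<le> a n"
  using less_LiminfD[OF assms(1)] eventually_gt_at_top[of 0]
proof eventually_elim
  case (elim n)
  then show ?case using ln_growth_eq(2)[of "a n" n 1 s] assms(2) by simp
qed

context compactly_supported_prob
begin

definition partition_sum :: "nat \<Rightarrow> real \<Rightarrow> real" where
  "partition_sum n q = (\<Sum>C\<in>pos_cubes n. prob C powr q)"

lemma Lq_spectrum_at_eq: "Lq_spectrum_at \<nu> n q = ln (partition_sum n q) / ln (2 ^ n)"
proof -
  \<comment> \<open>Null cubes drop out also for \<open>q = 0\<close>, because
    \<open>0 powr 0 = 0\<close>.\<close>
  have "(\<Sum>\<^sub>\<infinity>C\<in>dyadic_cubes n. measure \<nu> C powr q) = (\<Sum>\<^sub>\<infinity>C\<in>pos_cubes n. measure \<nu> C powr q)"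
    by (rule infsum_cong_neutral) (auto simp: pos_cubes_def not_less measure_le_0_iff)
  then show ?thesis
    by (simp add: Lq_spectrum_at_def partition_sum_def pos_cubes_finite)
qed

lemma pos_cubes_nonempty: "pos_cubes n \<noteq> {}"
  using sum_prob_pos_cubes[of n] by auto

lemma partition_sum_pos: "partition_sum n q > 0"
  unfolding partition_sum_def
  by (rule sum_pos) (auto simp: pos_cubes_finite pos_cubes_nonempty dest: pos_cubesD)

lemma partition_sum_antimono: "p \<le> q \<Longrightarrow> partition_sum n q \<le> partition_sum n p"
  unfolding partition_sum_def
  by (intro sum_mono powr_mono') auto

lemma partition_sum_1 [simp]: "partition_sum n 1 = 1"
  unfolding partition_sum_def using sum_prob_pos_cubes[of n] by simp

lemma partition_sum_ge_1: "q \<le> 1 \<Longrightarrow> 1 \<le> partition_sum n q"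
  using partition_sum_antimono[of q 1 n] by simp

text \<open>Young's inequality, applied to \<open>prob C powr q / partition_sum n q\<close> and
  \<open>1 / card (pos_cubes n)\<close>, both of which sum to \<open>1\<close>.\<close>

lemma partition_sum_interpolation:
  assumes "0 \<le> \<theta>" "\<theta> \<le> 1"
  shows "partition_sum n ((1 - \<theta>) * q)
           \<le> real (card (pos_cubes n)) powr \<theta> * partition_sum n q powr (1 - \<theta>)"
proof -
  let ?S = "partition_sum n q" and ?N = "real (card (pos_cubes n))"
  have N: "?N > 0" using pos_cubes_nonempty pos_cubes_finite by (simp add: card_gt_0_iff)
  have S: "?S > 0" by (rule partition_sum_pos)
  have "(\<Sum>C\<in>pos_cubes n. (prob C powr q / ?S) powr (1 - \<theta>) * (1 / ?N) powr \<theta>)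
      \<le> (\<Sum>C\<in>pos_cubes n. (1 - \<theta>) * (prob C powr q / ?S) + \<theta> * (1 / ?N))"
    using assms N S
    by (intro sum_mono Youngs_inequality_0) (auto dest: pos_cubesD)
  also have "\<dots> = (1 - \<theta>) * (\<Sum>C\<in>pos_cubes n. prob C powr q / ?S) + \<theta>"
    using N by (simp add: sum.distrib sum_distrib_left)
  also have "(\<Sum>C\<in>pos_cubes n. prob C powr q / ?S) = 1"
    using S by (simp add: sum_divide_distrib[symmetric] partition_sum_def)
  finally have "(\<Sum>C\<in>pos_cubes n. (prob C powr q / ?S) powr (1 - \<theta>) * (1 / ?N) powr \<theta>) \<le> 1"
    by simp
  also have "(\<Sum>C\<in>pos_cubes n. (prob C powr q / ?S) powr (1 - \<theta>) * (1 / ?N) powr \<theta>)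
      = partition_sum n ((1 - \<theta>) * q) / (?N powr \<theta> * ?S powr (1 - \<theta>))"
    using N S
    by (simp add: partition_sum_def sum_divide_distrib powr_divide powr_powr mult.commute)
  finally show ?thesis using N S by (simp add: divide_le_eq)
qed

lemma Lq_spectrum_eq: "Lq_spectrum \<nu> q = limsup (\<lambda>n. ereal (ln (partition_sum n q) / ln (2 ^ n)))"
  by (simp add: Lq_spectrum_def Lq_spectrum_at_eq)

lemma lower_Lq_spectrum_eq:
  "lower_Lq_spectrum \<nu> q = liminf (\<lambda>n. ereal (ln (partition_sum n q) / ln (2 ^ n)))"
  by (simp add: lower_Lq_spectrum_def Lq_spectrum_at_eq)

lemma Lq_spectrum_lessD:
  "Lq_spectrum \<nu> q < ereal s \<Longrightarrow> \<forall>\<^sub>F n in sequentially. partition_sum n q \<le> 2 powr (real n * s)"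
  unfolding Lq_spectrum_eq by (rule limsup_ln_growth_lessD) (auto simp: partition_sum_pos)

lemma lower_Lq_spectrum_lessD:
  "ereal s < lower_Lq_spectrum \<nu> q \<Longrightarrow> \<forall>\<^sub>F n in sequentially. 2 powr (real n * s) \<le> partition_sum n q"
  unfolding lower_Lq_spectrum_eq by (rule liminf_ln_growth_lessD) (auto simp: partition_sum_pos)

lemma Lq_spectrum_leI:
  "c > 0 \<Longrightarrow> \<forall>\<^sub>F n in sequentially. partition_sum n q \<le> c * 2 powr (real n * s) \<Longrightarrow> Lq_spectrum \<nu> q \<le> ereal s"
  unfolding Lq_spectrum_eq by (rule limsup_ln_growth_le) (auto simp: partition_sum_pos)

text \<open>Growth rates in \<open>partition_sum_interpolation\<close>, where the number of charged
  cubes grows at rate at most \<open>CARD('d)\<close>. This is convexity between \<open>0\<close>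
  and \<open>q\<close>, with the value at \<open>0\<close> replaced by the dimension.\<close>

lemma Lq_spectrum_interpolation:
  assumes \<theta>: "0 \<le> \<theta>" "\<theta> \<le> 1" and le: "Lq_spectrum \<nu> q \<le> ereal s"
  shows "Lq_spectrum \<nu> ((1 - \<theta>) * q) \<le> ereal (\<theta> * real CARD('d) + (1 - \<theta>) * s)"
proof (rule ereal_le_epsilon2)
  fix e :: real assume e: "e > 0"
  let ?M = "real cube_const"
  have M: "?M > 0" using cube_const_pos by simp
  have "Lq_spectrum \<nu> q < ereal (s + e)"
    using le e by (metis ereal_less_eq(3) less_add_same_cancel1 linorder_not_le order_trans)
  from Lq_spectrum_lessD[OF this]
  have "\<forall>\<^sub>F n in sequentially. partition_sum n ((1 - \<theta>) * q)
      \<le> ?M powr \<theta> * 2 powr (real n * (\<theta> * real CARD('d) + (1 - \<theta>) * (s + e)))"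
  proof eventually_elim
    case (elim n)
    have "partition_sum n ((1 - \<theta>) * q)
           \<le> real (card (pos_cubes n)) powr \<theta> * partition_sum n q powr (1 - \<theta>)"
      by (rule partition_sum_interpolation[OF \<theta>])
    also have "\<dots> \<le> (?M * 2 ^ (CARD('d) * n)) powr \<theta> * (2 powr (real n * (s + e))) powr (1 - \<theta>)"
      using elim \<theta> card_pos_cubes_le[of n] partition_sum_pos[of n q]
      by (intro mult_mono powr_mono2) auto
    also have "\<dots> = ?M powr \<theta> * 2 powr (real n * (\<theta> * real CARD('d) + (1 - \<theta>) * (s + e)))"
      using M by (simp add: powr_mult powr_powr powr_realpow[symmetric] powr_add[symmetric] algebra_simps)
    finally show ?case .
  qed
  then have "Lq_spectrum \<nu> ((1 - \<theta>) * q) \<le> ereal (\<theta> * real CARD('d) + (1 - \<theta>) * (s + e))"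
    by (rule Lq_spectrum_leI[rotated]) (use M in simp)
  also have "\<dots> \<le> ereal (\<theta> * real CARD('d) + (1 - \<theta>) * s) + ereal e"
    using \<theta> e by (simp add: algebra_simps)
  finally show "Lq_spectrum \<nu> ((1 - \<theta>) * q) \<le> ereal (\<theta> * real CARD('d) + (1 - \<theta>) * s) + ereal e" .
qed

lemma Lq_spectrum_1: "Lq_spectrum \<nu> 1 = 0"
  by (simp add: Lq_spectrum_eq zero_ereal_def[symmetric] Limsup_const)

text \<open>Interpolation starting from \<open>q = 1\<close>, where the spectrum vanishes.\<close>

lemma Lq_spectrum_le_dim:
  assumes "0 \<le> q" "q \<le> 1" shows "Lq_spectrum \<nu> q \<le> ereal (real CARD('d) * (1 - q))"
  using Lq_spectrum_interpolation[of "1 - q" 1 0] assms by (simp add: Lq_spectrum_1 mult.commute)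

lemma Lq_spectrum_nonneg:
  assumes "q \<le> 1" shows "0 \<le> Lq_spectrum \<nu> q"
proof -
  have "0 \<le> ln (partition_sum n q) / ln (2 ^ n)" for n
    using partition_sum_ge_1[OF assms, of n] by (simp add: ln_realpow)
  then have "0 \<le> liminf (\<lambda>n. ereal (ln (partition_sum n q) / ln (2 ^ n)))"
    by (intro Liminf_bounded always_eventually) auto
  also have "\<dots> \<le> limsup (\<lambda>n. ereal (ln (partition_sum n q) / ln (2 ^ n)))"
    by (rule Liminf_le_Limsup) simp
  finally show ?thesis by (simp add: Lq_spectrum_eq)
qed

text \<open>A real version for arithmetic; \<open>ereal_spectrum\<close> shows that nothing is lost
  on \<open>[0, 1]\<close>, where the spectrum is finite.\<close>

definition spectrum :: "real \<Rightarrow> real" where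
  "spectrum q = real_of_ereal (Lq_spectrum \<nu> q)"

lemma ereal_spectrum:
  assumes "0 \<le> q" "q \<le> 1" shows "ereal (spectrum q) = Lq_spectrum \<nu> q"
  unfolding spectrum_def
  using Lq_spectrum_nonneg[of q] Lq_spectrum_le_dim[of q] assms
  by (cases "Lq_spectrum \<nu> q") auto

lemma spectrum_bounds:
  assumes "0 \<le> q" "q \<le> 1" shows "0 \<le> spectrum q" "spectrum q \<le> real CARD('d)"
proof -
  have "0 \<le> ereal (spectrum q)" "ereal (spectrum q) \<le> ereal (real CARD('d) * (1 - q))"
    using Lq_spectrum_nonneg[of q] Lq_spectrum_le_dim[of q] assms by (auto simp: ereal_spectrum)
  moreover have "real CARD('d) * (1 - q) \<le> real CARD('d)"
    using assms by (intro mult_left_le) auto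
  ultimately show "0 \<le> spectrum q" "spectrum q \<le> real CARD('d)"
    unfolding ereal_less_eq(3) zero_ereal_def by linarith+
qed

lemma spectrum_antimono:
  assumes "0 \<le> p" "p \<le> q" "q \<le> 1" shows "spectrum q \<le> spectrum p"
proof -
  have "Lq_spectrum \<nu> q \<le> Lq_spectrum \<nu> p" unfolding Lq_spectrum_eq
  proof (intro Limsup_mono always_eventually allI)
    fix n
    show "ereal (ln (partition_sum n q) / ln (2 ^ n)) \<le> ereal (ln (partition_sum n p) / ln (2 ^ n))"
      using partition_sum_antimono[OF assms(2), of n] partition_sum_pos[of n]
      by (auto simp: ln_realpow intro!: divide_right_mono)
  qed
  then have "ereal (spectrum q) \<le> ereal (spectrum p)"
    using assms by (simp add: ereal_spectrum)
  then show ?thesis by simp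
qed

lemma spectrum_interpolation:
  assumes "0 \<le> \<theta>" "\<theta> \<le> 1" "0 \<le> q" "q \<le> 1"
  shows "spectrum ((1 - \<theta>) * q) \<le> \<theta> * real CARD('d) + (1 - \<theta>) * spectrum q"
proof -
  have "0 \<le> (1 - \<theta>) * q" "(1 - \<theta>) * q \<le> 1" using assms by (auto intro: mult_le_one)
  then show ?thesis
    using Lq_spectrum_interpolation[of \<theta> q "spectrum q"] assms
    by (simp add: ereal_spectrum[symmetric])
qed

end

section \<open>The critical exponent\<close>

locale quantization_setting = compactly_supported_prob \<nu> for \<nu> :: "(real^'d) measure" +
  fixes r :: real
  assumes r_pos: "r > 0"
begin

abbreviation crit :: real where "crit \<equiv> critical_q \<nu> r"

lemma crit_set_1: "1 \<in> {q. q > 0 \<and> Lq_spectrum \<nu> q < ereal (r * q)}"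
  using r_pos by (simp add: Lq_spectrum_1)

lemma crit_set_bdd: "bdd_below {q. q > 0 \<and> Lq_spectrum \<nu> q < ereal (r * q)}"
  by (rule bdd_belowI[of _ 0]) auto

lemma crit_nonneg: "0 \<le> crit"
  unfolding critical_q_def by (rule cInf_greatest) (use crit_set_1 in blast, auto)

lemma crit_le: "q > 0 \<Longrightarrow> Lq_spectrum \<nu> q < ereal (r * q) \<Longrightarrow> crit \<le> q"
  unfolding critical_q_def by (intro cInf_lower crit_set_bdd) auto

text \<open>The spectrum lies below the line \<open>CARD('d) * (1 - q)\<close>, which crosses
  \<open>r * q\<close> before \<open>1\<close>. Strictness keeps
  \<open>r * crit / (1 - crit)\<close> finite.\<close>

lemma crit_less_1: "crit < 1"
proof -
  let ?d = "real CARD('d)"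
  \<comment> \<open>The midpoint between \<open>1\<close> and the crossing point
    \<open>?d / (?d + r)\<close>.\<close>
  define q where "q = (?d + r / 2) / (?d + r)"
  have q: "0 < q" "q < 1" using r_pos by (auto simp: q_def add_pos_pos)
  have "1 - q = (r / 2) / (?d + r)"
    using add_pos_pos[OF _ r_pos, of ?d] by (simp add: q_def diff_divide_eq_iff)
  then have "?d * (1 - q) = ?d * (r / 2) / (?d + r)" by simp
  also have "\<dots> < r * (?d + r / 2) / (?d + r)"
    using r_pos mult_pos_pos[OF r_pos r_pos] mult_pos_pos[OF r_pos, of ?d]
    by (intro divide_strict_right_mono) (auto simp: algebra_simps add_pos_pos)
  also have "\<dots> = r * q" by (simp add: q_def)
  finally have "Lq_spectrum \<nu> q < ereal (r * q)"
    using Lq_spectrum_le_dim[of q] q by (simp add: le_less_trans)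
  then show ?thesis using crit_le[OF q(1)] q(2) by linarith
qed

lemma spectrum_ge_of_less_crit:
  assumes "0 < q" "q < crit" shows "r * q \<le> spectrum q"
proof -
  have "ereal (r * q) \<le> Lq_spectrum \<nu> q" using crit_le[of q] assms by (meson not_le)
  then show ?thesis using assms crit_less_1 by (simp add: ereal_spectrum[symmetric])
qed

text \<open>The infimum itself may fail the strict inequality, so arguments needing it use points
  \<open>p\<close> close to \<open>crit\<close> from the right and then pass to the limit.\<close>

lemma crit_approx:
  assumes "crit < q" obtains p where "crit \<le> p" "p < q" "p > 0" "p < 1" "spectrum p < r * p"
proof -
  have "Inf {q. q > 0 \<and> Lq_spectrum \<nu> q < ereal (r * q)} < min q 1"
    using assms crit_less_1 by (simp add: critical_q_def)
  then obtain p where p: "p > 0" "Lq_spectrum \<nu> p < ereal (r * p)" "p < min q 1"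
    using cInf_lessD[of "{q. q > 0 \<and> Lq_spectrum \<nu> q < ereal (r * q)}"] crit_set_1 by blast
  moreover have "spectrum p < r * p" using p by (simp add: ereal_spectrum[symmetric])
  ultimately show ?thesis using crit_le[of p] by (intro that[of p]) auto
qed

text \<open>Interpolation replaces continuity: from points \<open>p\<close> just right of
  \<open>crit\<close> down to \<open>crit\<close> for the upper bound, and from \<open>crit\<close>
  to points just left of it for the lower bound.\<close>

lemma spectrum_crit:
  assumes "crit > 0" shows "spectrum crit = r * crit"
proof (rule antisym)
  let ?d = "real CARD('d)"
  show "spectrum crit \<le> r * crit"
  proof (rule field_le_epsilon)
    fix e :: real assume e: "e > 0"
    \<comment> \<open>A point \<open>p\<close> below this bound gives
      \<open>\<theta> = 1 - crit / p \<le> e / ?d\<close>; the minimum with \<open>1/2\<close> keeps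
      the denominator positive.\<close>
    have "crit < crit / (1 - min (1/2) (e / ?d))"
      using assms e by (simp add: less_divide_eq)
    then obtain p where p: "crit \<le> p" "p < crit / (1 - min (1/2) (e / ?d))" "p > 0" "p < 1" "spectrum p < r * p"
      by (rule crit_approx)
    define \<theta> where "\<theta> = 1 - crit / p"
    have \<theta>: "0 \<le> \<theta>" "\<theta> \<le> 1" "(1 - \<theta>) * p = crit" using p assms by (auto simp: \<theta>_def)
    have "p * (1 - min (1/2) (e / ?d)) < crit"
      using p(2) e by (simp add: less_divide_eq)
    then have "1 - min (1/2) (e / ?d) < crit / p" using p(3) by (simp add: field_simps)
    then have "\<theta> \<le> e / ?d" unfolding \<theta>_def by linarith
    then have "\<theta> * ?d \<le> e" by (simp add: field_simps)
    moreover have "(1 - \<theta>) * spectrum p \<le> (1 - \<theta>) * (r * p)"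
      using p \<theta> by (intro mult_left_mono) auto
    moreover have "(1 - \<theta>) * (r * p) = r * crit" by (simp flip: \<theta>(3))
    ultimately show "spectrum crit \<le> r * crit + e"
      using spectrum_interpolation[of \<theta> p] p \<theta>(1,2) unfolding \<theta>(3) by linarith
  qed
  show "r * crit \<le> spectrum crit"
  proof (rule field_le_epsilon)
    fix e :: real assume e: "e > 0"
    \<comment> \<open>Moving left costs \<open>\<theta> * ?d\<close> in the interpolation and
      \<open>\<theta> * r * crit\<close> on the line \<open>r * q\<close>; together at most
      \<open>e\<close>.\<close>
    define \<theta> where "\<theta> = min (1/2) (e / (?d + r * crit))"
    have pos: "?d + r * crit > 0" using r_pos assms by (simp add: add_pos_pos)
    have \<theta>: "0 < \<theta>" "\<theta> < 1" using e pos by (auto simp: \<theta>_def)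
    have "\<theta> \<le> e / (?d + r * crit)" by (simp add: \<theta>_def)
    then have small: "\<theta> * (?d + r * crit) \<le> e" using pos by (simp add: pos_le_divide_eq)
    have "r * ((1 - \<theta>) * crit) \<le> spectrum ((1 - \<theta>) * crit)"
      using \<theta> assms by (intro spectrum_ge_of_less_crit) auto
    also have "\<dots> \<le> \<theta> * ?d + (1 - \<theta>) * spectrum crit"
      using \<theta> assms crit_less_1 by (intro spectrum_interpolation) auto
    also have "\<dots> \<le> \<theta> * ?d + spectrum crit"
      using \<theta> spectrum_bounds(1)[of crit] assms crit_less_1 by (simp add: mult_left_le_one_le)
    finally show "r * crit \<le> spectrum crit + e" using small by (simp add: algebra_simps)
  qed
qed

end

subsection \<open>Coarse counts\<close>

text \<open>If all second differences on an equidistant grid were at least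
  \<open>\<eta> * \<delta>\<close>, the first differences would grow linearly. Their sum would then
  grow with the number of grid steps and exceed the fixed total drop
  \<open>f lo - f hi\<close>.\<close>

lemma antimono_small_second_difference:
  fixes f :: "real \<Rightarrow> real"
  assumes "lo < hi" "\<eta> > 0"
    and anti: "\<And>x y. lo \<le> x \<Longrightarrow> x \<le> y \<Longrightarrow> y \<le> hi \<Longrightarrow> f y \<le> f x"
  obtains q \<delta> where "\<delta> > 0" "lo \<le> q - \<delta>" "q + \<delta> \<le> hi" "f (q + \<delta>) - 2 * f q + f (q - \<delta>) < \<eta> * \<delta>"
proof -
  obtain m where m: "f lo - f hi < real m * (\<eta> * (hi - lo) / 2)"
    using reals_Archimedean3[of "\<eta> * (hi - lo) / 2"] assms(1,2) by (meson diff_gt_0_iff_gt half_gt_zero mult_pos_pos)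
  \<comment> \<open>Summed over \<open>K\<close> steps, the assumed second differences force a drop
    of \<open>(K - 1) * (\<eta> * (hi - lo) / 2)\<close>, here \<open>m + 1\<close> times the unit
    used to choose \<open>m\<close>.\<close>
  define K where "K = m + 2"
  define \<delta> where "\<delta> = (hi - lo) / real K"
  \<comment> \<open>The grid is traversed from \<open>hi\<close> to the left, so that the
    antimonotone \<open>f\<close> yields nonnegative first differences.\<close>
  define g where "g i = f (hi - real i * \<delta>)" for i :: nat
  have \<delta>: "\<delta> > 0" "real K * \<delta> = hi - lo" using assms by (auto simp: \<delta>_def K_def)
  have range: "lo \<le> hi - real i * \<delta>" if "i \<le> K" for i
  proof -
    have "real i * \<delta> \<le> real K * \<delta>" using that \<delta>(1) by (intro mult_right_mono) auto
    then show ?thesis using \<delta>(2) by linarith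
  qed
  have "\<exists>i. i + 2 \<le> K \<and> g (i + 2) - 2 * g (i + 1) + g i < \<eta> * \<delta>"
  proof (rule ccontr)
    assume "\<not> ?thesis"
    then have big: "\<eta> * \<delta> \<le> g (i + 2) - 2 * g (i + 1) + g i" if "i + 2 \<le> K" for i
      using that by (meson not_less)
    have step: "real i * (\<eta> * \<delta>) \<le> g (i + 1) - g i" if "i + 1 \<le> K" for i
      using that
    proof (induction i)
      case 0
      then show ?case using anti[of "hi - \<delta>" hi] range[of 1] \<delta> by (simp add: g_def)
    next
      case (Suc i)
      then show ?case using big[of i] by (simp add: algebra_simps)
    qed
    have "real i * (real i - 1) / 2 * (\<eta> * \<delta>) \<le> g i - g 0" if "i \<le> K" for i
      using that
    proof (induction i)
      case (Suc i)
      have "real (Suc i) * (real (Suc i) - 1) / 2 * (\<eta> * \<delta>)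
          = real i * (real i - 1) / 2 * (\<eta> * \<delta>) + real i * (\<eta> * \<delta>)"
        by (simp add: field_simps)
      then show ?case using Suc step[of i] by simp
    qed simp
    from this[of K] have "real K * (real K - 1) / 2 * (\<eta> * \<delta>) \<le> f lo - f hi"
      using \<delta>(2) by (simp add: g_def)
    also have "real K * (real K - 1) / 2 * (\<eta> * \<delta>) = (real K * \<delta>) * (real K - 1) / 2 * \<eta>"
      by simp
    also have "\<dots> = (real m + 1) * (\<eta> * (hi - lo) / 2)"
      unfolding \<delta>(2) by (simp add: K_def)
    also have "\<dots> \<ge> real m * (\<eta> * (hi - lo) / 2)"
      using assms by (intro mult_right_mono) auto
    finally show False using m by simp
  qed
  then obtain i where i: "i + 2 \<le> K" "g (i + 2) - 2 * g (i + 1) + g i < \<eta> * \<delta>" by blast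
  have eq: "hi - real (i + 2) * \<delta> = (hi - real (i + 1) * \<delta>) - \<delta>"
    "hi - real i * \<delta> = (hi - real (i + 1) * \<delta>) + \<delta>" by (simp_all add: algebra_simps)
  show ?thesis
  proof (rule that[of \<delta> "hi - real (i + 1) * \<delta>"])
    show "lo \<le> hi - real (i + 1) * \<delta> - \<delta>" using range[OF i(1)] eq by simp
    show "hi - real (i + 1) * \<delta> + \<delta> \<le> hi" using \<delta>(1) by (simp flip: eq(2))
    show "f (hi - real (i + 1) * \<delta> + \<delta>) - 2 * f (hi - real (i + 1) * \<delta>)
        + f (hi - real (i + 1) * \<delta> - \<delta>) < \<eta> * \<delta>"
      using i(2) unfolding g_def eq by simp
  qed (rule \<delta>(1))
qed

text \<open>The difference quotients to the right and to the left are each within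
  \<open>\<eta> / 2\<close> of the derivative, which cancels in the second difference.\<close>

lemma differentiable_small_second_difference:
  fixes f :: "real \<Rightarrow> real"
  assumes "f differentiable (at x)" "\<eta> > 0" "e > 0"
  obtains \<delta> where "\<delta> > 0" "\<delta> < e" "f (x + \<delta>) - 2 * f x + f (x - \<delta>) < \<eta> * \<delta>"
proof -
  obtain D where "(f has_real_derivative D) (at x)"
    using assms(1) by (auto simp: real_differentiable_def)
  then have "(\<lambda>h. (f (x + h) - f x) / h) \<midarrow>0\<rightarrow> D" by (rule DERIV_D)
  then obtain d where d: "d > 0" "\<And>h. h \<noteq> 0 \<Longrightarrow> \<bar>h\<bar> < d \<Longrightarrow> \<bar>(f (x + h) - f x) / h - D\<bar> < \<eta> / 2"
    using assms(2) unfolding LIM_def by (metis half_gt_zero dist_real_def diff_zero)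
  define \<delta> where "\<delta> = min (d / 2) (e / 2)"
  have \<delta>: "\<delta> > 0" "\<delta> < d" "\<delta> < e" using d(1) assms(3) by (auto simp: \<delta>_def)
  have "\<bar>(f (x + \<delta>) - f x) / \<delta> - D\<bar> < \<eta> / 2" "\<bar>(f (x - \<delta>) - f x) / (- \<delta>) - D\<bar> < \<eta> / 2"
    using d(2)[of \<delta>] d(2)[of "- \<delta>"] \<delta> by simp_all
  then have "(f (x + \<delta>) - f x) / \<delta> < D + \<eta> / 2" "(f (x - \<delta>) - f x) / (- \<delta>) > D - \<eta> / 2"
    by linarith+
  then have "f (x + \<delta>) - f x < (D + \<eta> / 2) * \<delta>" "f (x - \<delta>) - f x < (\<eta> / 2 - D) * \<delta>"
    using \<delta>(1) by (auto simp: field_simps)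
  then show ?thesis using that[of \<delta>] \<delta> by (simp add: algebra_simps)
qed

section \<open>The upper coarse dimension equals the critical exponent\<close>

context quantization_setting
begin

text \<open>The cubes of \<open>coarse_count\<close>, with the volume factor
  \<open>2 powr (- r * real n)\<close> moved to the other side. The threshold is positive, so
  requiring charged cubes excludes nothing.\<close>

definition coarse_cubes :: "real \<Rightarrow> nat \<Rightarrow> (real^'d) set set" where
  "coarse_cubes \<alpha> n = {C \<in> pos_cubes n. 2 powr ((r - \<alpha>) * real n) \<le> prob C}"

lemma coarse_cubes_subset: "coarse_cubes \<alpha> n \<subseteq> pos_cubes n"
  by (auto simp: coarse_cubes_def)

lemma coarse_cubes_finite: "finite (coarse_cubes \<alpha> n)"
  using coarse_cubes_subset pos_cubes_finite finite_subset by blast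

lemma coarse_count_eq: "coarse_count r \<nu> \<alpha> n = card (coarse_cubes \<alpha> n)"
proof -
  have "measure lborel Q powr (r / real CARD('d)) = 2 powr (- r * real n)"
    if "Q \<in> dyadic_cubes n" for Q :: "(real^'d) set"
  proof -
    have "(1 / 2 ^ n :: real) = 2 powr (- real n)"
      by (simp add: powr_minus powr_realpow divide_inverse)
    then show ?thesis
      by (simp add: measure_lborel_dyadic_cube[OF that] powr_realpow[symmetric] powr_powr mult.commute)
  qed
  moreover have "prob Q * 2 powr (- r * real n) \<ge> 2 powr (- \<alpha> * real n)
      \<longleftrightarrow> 2 powr ((r - \<alpha>) * real n) \<le> prob Q" for Q
  proof -
    have "2 powr ((r - \<alpha>) * real n) = 2 powr (- \<alpha> * real n) / 2 powr (- r * real n)"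
      by (simp add: powr_diff[symmetric] algebra_simps)
    then show ?thesis by (simp add: pos_divide_le_eq)
  qed
  ultimately have "{Q \<in> dyadic_cubes n. measure \<nu> Q * measure lborel Q powr (r / real CARD('d))
      \<ge> 2 powr (- \<alpha> * real n)} = {Q \<in> dyadic_cubes n. 2 powr ((r - \<alpha>) * real n) \<le> prob Q}"
    by auto
  also have "\<dots> = coarse_cubes \<alpha> n"
  proof -
    have "0 < prob Q" if "2 powr ((r - \<alpha>) * real n) \<le> prob Q" for Q
      by (rule less_le_trans[OF _ that]) simp
    then show ?thesis by (auto simp: coarse_cubes_def pos_cubes_def)
  qed
  finally show ?thesis by (simp add: coarse_count_def)
qed

text \<open>Truncating the count at \<open>1\<close> expresses \<open>log_plus\<close> as a
  logarithm of a positive sequence, as the growth lemmas require.\<close>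

lemma log_plus_coarse_count:
  "log_plus (real (coarse_count r \<nu> \<alpha> n)) = ln (max 1 (real (card (coarse_cubes \<alpha> n))))"
  by (auto simp: log_plus_def coarse_count_eq max_def)

lemma upper_coarse_dim_at_eq:
  "upper_coarse_dim_at r \<nu> \<alpha>
     = limsup (\<lambda>n. ereal (ln (max 1 (real (card (coarse_cubes \<alpha> n)))) / ln (2 ^ n)))"
  by (simp add: upper_coarse_dim_at_def log_plus_coarse_count)

lemma lower_coarse_dim_at_eq:
  "lower_coarse_dim_at r \<nu> \<alpha>
     = liminf (\<lambda>n. ereal (ln (max 1 (real (card (coarse_cubes \<alpha> n)))) / ln (2 ^ n)))"
  by (simp add: lower_coarse_dim_at_def log_plus_coarse_count)

lemma lower_le_upper_coarse_dim: "lower_coarse_dim r \<nu> \<le> upper_coarse_dim r \<nu>"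
  unfolding lower_coarse_dim_def upper_coarse_dim_def
proof (rule SUP_mono)
  fix \<alpha> :: real assume \<alpha>: "\<alpha> \<in> {0<..}"
  then have "lower_coarse_dim_at r \<nu> \<alpha> / ereal \<alpha> \<le> upper_coarse_dim_at r \<nu> \<alpha> / ereal \<alpha>"
    unfolding lower_coarse_dim_at_eq upper_coarse_dim_at_eq
    by (intro ereal_divide_right_mono Liminf_le_Limsup) auto
  with \<alpha> show "\<exists>m\<in>{0<..}. lower_coarse_dim_at r \<nu> \<alpha> / ereal \<alpha> \<le> upper_coarse_dim_at r \<nu> m / ereal m"
    by blast
qed

lemma lower_coarse_dim_nonneg: "0 \<le> lower_coarse_dim r \<nu>"
proof -
  have "0 \<le> lower_coarse_dim_at r \<nu> 1"
    unfolding lower_coarse_dim_at_eq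
    by (intro Liminf_bounded always_eventually) (auto simp: ln_realpow)
  then have "0 \<le> lower_coarse_dim_at r \<nu> 1 / ereal 1" by simp
  also have "\<dots> \<le> lower_coarse_dim r \<nu>"
    unfolding lower_coarse_dim_def by (intro SUP_upper) simp
  finally show ?thesis .
qed

text \<open>Markov's inequality for the \<open>q\<close>-th powers of the masses.\<close>

lemma card_coarse_cubes_le:
  assumes "0 < q"
  shows "real (card (coarse_cubes \<alpha> n)) \<le> 2 powr (real n * ((\<alpha> - r) * q)) * partition_sum n q"
proof -
  have "real (card (coarse_cubes \<alpha> n)) * 2 powr ((r - \<alpha>) * real n * q)
      = (\<Sum>C\<in>coarse_cubes \<alpha> n. (2 powr ((r - \<alpha>) * real n)) powr q)"
    by (simp add: powr_powr)
  also have "\<dots> \<le> (\<Sum>C\<in>coarse_cubes \<alpha> n. prob C powr q)"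
    using assms by (intro sum_mono powr_mono2) (auto simp: coarse_cubes_def)
  also have "\<dots> \<le> partition_sum n q"
    unfolding partition_sum_def
    by (intro sum_mono2 pos_cubes_finite coarse_cubes_subset) auto
  finally have "real (card (coarse_cubes \<alpha> n)) * 2 powr ((r - \<alpha>) * real n * q) \<le> partition_sum n q" .
  then have "2 powr (real n * ((\<alpha> - r) * q)) * (real (card (coarse_cubes \<alpha> n)) * 2 powr ((r - \<alpha>) * real n * q))
      \<le> 2 powr (real n * ((\<alpha> - r) * q)) * partition_sum n q"
    by (intro mult_left_mono) auto
  moreover have "2 powr (real n * ((\<alpha> - r) * q)) * 2 powr ((r - \<alpha>) * real n * q) = (1 :: real)"
    by (simp add: powr_add[symmetric] algebra_simps)
  ultimately show ?thesis by (metis mult.left_commute mult.right_neutral)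
qed

text \<open>If \<open>spectrum p < r * p\<close>, Markov's inequality bounds the count by
  \<open>2 powr (real n * (\<alpha> * p))\<close>, since the terms with \<open>r\<close> cancel;
  then \<open>p\<close> approaches \<open>crit\<close>.\<close>

lemma upper_coarse_dim_le_crit: "upper_coarse_dim r \<nu> \<le> ereal crit"
  unfolding upper_coarse_dim_def
proof (rule SUP_least)
  fix \<alpha> :: real assume "\<alpha> \<in> {0<..}"
  then have \<alpha>: "\<alpha> > 0" by simp
  have "upper_coarse_dim_at r \<nu> \<alpha> \<le> ereal (\<alpha> * crit)"
  proof (rule ereal_le_epsilon2)
    fix e :: real assume e: "e > 0"
    then have "crit < crit + e / \<alpha>" using \<alpha> by simp
    then obtain p where p: "p < crit + e / \<alpha>" "p > 0" "p < 1" "spectrum p < r * p"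
      by (rule crit_approx)
    have "Lq_spectrum \<nu> p < ereal (r * p)" using p by (simp add: ereal_spectrum[symmetric])
    from Lq_spectrum_lessD[OF this]
    have "\<forall>\<^sub>F n in sequentially. 0 < max 1 (real (card (coarse_cubes \<alpha> n))) \<and>
        max 1 (real (card (coarse_cubes \<alpha> n))) \<le> 1 * 2 powr (real n * (\<alpha> * p))"
    proof eventually_elim
      case (elim n)
      have "real (card (coarse_cubes \<alpha> n)) \<le> 2 powr (real n * ((\<alpha> - r) * p)) * 2 powr (real n * (r * p))"
        using card_coarse_cubes_le[OF p(2), of \<alpha> n] elim
        by (meson mult_left_mono order_trans powr_ge_zero)
      also have "\<dots> = 2 powr (real n * (\<alpha> * p))"
        by (simp add: powr_add[symmetric] algebra_simps)
      finally show ?case using \<alpha> p by (simp add: ge_one_powr_ge_zero)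
    qed
    then have "upper_coarse_dim_at r \<nu> \<alpha> \<le> ereal (\<alpha> * p)"
      unfolding upper_coarse_dim_at_eq by (rule limsup_ln_growth_le[rotated]) simp
    also have "\<dots> \<le> ereal (\<alpha> * crit) + ereal e"
      using p(1) \<alpha> by (simp add: field_simps)
    finally show "upper_coarse_dim_at r \<nu> \<alpha> \<le> ereal (\<alpha> * crit) + ereal e" .
  qed
  then show "upper_coarse_dim_at r \<nu> \<alpha> / ereal \<alpha> \<le> ereal crit"
    using \<alpha> by (subst ereal_divide_le_pos) auto
qed

lemma coarse_cubes_empty:
  assumes "\<alpha> < r" "n > 0" shows "coarse_cubes \<alpha> n = {}"
proof -
  have "1 < 2 powr ((r - \<alpha>) * real n)" using assms by (intro gr_one_powr) auto
  then have "\<not> 2 powr ((r - \<alpha>) * real n) \<le> prob C" for C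
    using prob_le_1[of C] by linarith
  then show ?thesis by (simp add: coarse_cubes_def)
qed

text \<open>Sorting the cubes by the first of the thresholds \<open>\<delta>, 2 * \<delta>, \<dots>, J * \<delta>\<close> at which they
  are counted.\<close>

lemma partition_sum_le_slices:
  assumes "n > 0" "\<delta> > 0" "q > 0"
  shows "partition_sum n q
    \<le> (\<Sum>j=1..J. real (card (coarse_cubes (real j * \<delta>) n)) * 2 powr ((r - (real j - 1) * \<delta>) * real n * q))
      + real (card (pos_cubes n)) * 2 powr ((r - real J * \<delta>) * real n * q)"
proof -
  have "prob C powr q
      \<le> (\<Sum>j=1..J. if C \<in> coarse_cubes (real j * \<delta>) n then 2 powr ((r - (real j - 1) * \<delta>) * real n * q) else 0)
        + 2 powr ((r - real J * \<delta>) * real n * q)"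
    (is "_ \<le> (\<Sum>j=1..J. ?t j) + ?u") if C: "C \<in> pos_cubes n" for C
  proof (cases "C \<in> coarse_cubes (real J * \<delta>) n")
    case False
    then have "prob C powr q \<le> (2 powr ((r - real J * \<delta>) * real n)) powr q"
      using C assms by (intro powr_mono2) (auto simp: coarse_cubes_def)
    moreover have "0 \<le> (\<Sum>j=1..J. ?t j)" by (intro sum_nonneg) auto
    ultimately show ?thesis by (simp add: powr_powr)
  next
    case True
    define j where "j = (LEAST j. C \<in> coarse_cubes (real j * \<delta>) n)"
    have j: "C \<in> coarse_cubes (real j * \<delta>) n" "j \<le> J"
      unfolding j_def using True by (auto intro: LeastI Least_le)
    \<comment> \<open>The threshold \<open>0\<close> lies below \<open>r\<close>, where nothing is
      counted at positive levels.\<close>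
    have "j \<noteq> 0"
      using j(1) coarse_cubes_empty[of 0 n] r_pos assms(1) by (cases "j = 0") auto
    \<comment> \<open>Missing the previous threshold bounds the mass from above; hence the exponent
      with \<open>j - 1\<close> beside the count at \<open>j\<close>.\<close>
    then have "C \<notin> coarse_cubes (real (j - 1) * \<delta>) n"
      unfolding j_def by (intro not_less_Least) (simp flip: j_def)
    moreover have "real (j - 1) = real j - 1" using \<open>j \<noteq> 0\<close> by simp
    ultimately have "prob C powr q \<le> (2 powr ((r - (real j - 1) * \<delta>) * real n)) powr q"
      using C assms by (intro powr_mono2) (auto simp: coarse_cubes_def)
    also have "\<dots> = ?t j" using j(1) by (simp add: powr_powr)
    also have "\<dots> \<le> (\<Sum>j=1..J. ?t j)"
      using j(2) \<open>j \<noteq> 0\<close> by (intro member_le_sum) auto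
    finally show ?thesis by (smt (verit) powr_ge_zero)
  qed
  moreover have count: "(\<Sum>C\<in>pos_cubes n. if C \<in> coarse_cubes (real j * \<delta>) n then c else 0)
      = real (card (coarse_cubes (real j * \<delta>) n)) * c" for j c
    using coarse_cubes_subset[of "real j * \<delta>" n]
    by (simp add: sum.If_cases[OF pos_cubes_finite] Int_absorb1)
  ultimately have "partition_sum n q \<le> (\<Sum>C\<in>pos_cubes n.
      (\<Sum>j=1..J. if C \<in> coarse_cubes (real j * \<delta>) n then 2 powr ((r - (real j - 1) * \<delta>) * real n * q) else 0)
        + 2 powr ((r - real J * \<delta>) * real n * q))"
    unfolding partition_sum_def by (intro sum_mono) blast
  also have "\<dots> = (\<Sum>j=1..J. \<Sum>C\<in>pos_cubes n.
      if C \<in> coarse_cubes (real j * \<delta>) n then 2 powr ((r - (real j - 1) * \<delta>) * real n * q) else 0)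
      + real (card (pos_cubes n)) * 2 powr ((r - real J * \<delta>) * real n * q)"
    unfolding sum.distrib by (subst sum.swap) simp
  finally show ?thesis unfolding count .
qed

text \<open>If the upper coarse dimension were below some \<open>p < q < crit\<close>, every slice
  of the partition sum would grow more slowly than \<open>2 powr (real n * (r * q))\<close>. Then
  \<open>Lq_spectrum \<nu> q < r * q\<close>, against \<open>q < crit\<close>.\<close>

lemma crit_le_upper_coarse_dim: "ereal crit \<le> upper_coarse_dim r \<nu>"
proof (rule ccontr)
  assume "\<not> ?thesis"
  then have "upper_coarse_dim r \<nu> < ereal crit" by simp
  then obtain p where p: "upper_coarse_dim r \<nu> < ereal p" "p < crit"
    by (metis ereal_dense2 ereal_less(5) less_ereal.simps(1))
  have "0 \<le> upper_coarse_dim r \<nu>"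
    using lower_coarse_dim_nonneg lower_le_upper_coarse_dim by (rule order_trans)
  then have "0 < p" using p(1) by (metis ereal_less(2) le_less_trans)
  define q where "q = (p + crit) / 2"
  have q: "p < q" "q < crit" "0 < q" using p(2) \<open>0 < p\<close> by (auto simp: q_def)
  \<comment> \<open>Only thresholds \<open>j * \<delta> \<ge> r\<close> count, so the smaller counts
    gain at least \<open>r * (q - p) = 2 * g\<close> in the exponent. The mesh costs
    \<open>\<delta> * q = g\<close>, and a net gain of \<open>g\<close> remains.\<close>
  define g where "g = r * (q - p) / 2"
  define \<delta> where "\<delta> = g / q"
  have g: "g > 0" "\<delta> > 0" "\<delta> * q = g" using q r_pos by (auto simp: g_def \<delta>_def)
  \<comment> \<open>Beyond the last threshold the masses are so small that the crude bound on the
    number of charged cubes suffices.\<close>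
  obtain J where J: "real CARD('d) + g < real J * (\<delta> * q)"
    using reals_Archimedean3[of "\<delta> * q"] g by auto
  have "\<forall>\<^sub>F n in sequentially. \<forall>j\<in>{1..J}. max 1 (real (card (coarse_cubes (real j * \<delta>) n)))
      \<le> 2 powr (real n * (real j * \<delta> * p))"
  proof (intro eventually_ball_finite ballI)
    fix j assume j: "j \<in> {1..J}"
    have pos: "real j * \<delta> > 0" using j g by simp
    have "upper_coarse_dim_at r \<nu> (real j * \<delta>) / ereal (real j * \<delta>) \<le> upper_coarse_dim r \<nu>"
      unfolding upper_coarse_dim_def using pos by (intro SUP_upper) simp
    also note p(1)
    finally have "upper_coarse_dim_at r \<nu> (real j * \<delta>) < ereal (real j * \<delta>) * ereal p"
      using pos by (subst (asm) ereal_divide_less_pos) auto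
    then show "\<forall>\<^sub>F n in sequentially. max 1 (real (card (coarse_cubes (real j * \<delta>) n)))
      \<le> 2 powr (real n * (real j * \<delta> * p))"
      unfolding upper_coarse_dim_at_eq by (intro limsup_ln_growth_lessD) auto
  qed simp
  then have "\<forall>\<^sub>F n in sequentially. partition_sum n q
      \<le> (real J + real cube_const) * 2 powr (real n * (r * q - g))"
    using eventually_gt_at_top[of 0]
  proof eventually_elim
    case (elim n)
    let ?x = "2 powr (real n * (r * q - g))"
    have "real (card (coarse_cubes (real j * \<delta>) n)) * 2 powr ((r - (real j - 1) * \<delta>) * real n * q) \<le> ?x"
      if j: "j \<in> {1..J}" for j
    proof (cases "real j * \<delta> < r")
      case True
      then show ?thesis using elim by (simp add: coarse_cubes_empty)
    next
      case False
      have "real (card (coarse_cubes (real j * \<delta>) n)) * 2 powr ((r - (real j - 1) * \<delta>) * real n * q)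
          \<le> 2 powr (real n * (real j * \<delta> * p)) * 2 powr ((r - (real j - 1) * \<delta>) * real n * q)"
        using elim(1) j by (intro mult_right_mono) (auto dest!: bspec[of _ _ j])
      also have "\<dots> = 2 powr (real n * (r * q + g - real j * \<delta> * (q - p)))"
        by (simp add: powr_add[symmetric] algebra_simps flip: g(3))
      also have "\<dots> \<le> ?x"
      proof -
        have "r * (q - p) \<le> real j * \<delta> * (q - p)" using False q by (intro mult_right_mono) auto
        then have "2 * g \<le> real j * \<delta> * (q - p)" by (simp add: g_def)
        then show ?thesis by (intro powr_mono mult_left_mono) auto
      qed
      finally show ?thesis .
    qed
    then have "(\<Sum>j=1..J. real (card (coarse_cubes (real j * \<delta>) n)) * 2 powr ((r - (real j - 1) * \<delta>) * real n * q))
        \<le> real J * ?x"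
      using sum_mono[of "{1..J}" _ "\<lambda>_. ?x"] by simp
    moreover have "real (card (pos_cubes n)) * 2 powr ((r - real J * \<delta>) * real n * q) \<le> real cube_const * ?x"
    proof -
      have "real (card (pos_cubes n)) * 2 powr ((r - real J * \<delta>) * real n * q)
          \<le> real cube_const * 2 ^ (CARD('d) * n) * 2 powr ((r - real J * \<delta>) * real n * q)"
        by (intro mult_right_mono card_pos_cubes_le) auto
      also have "\<dots> = real cube_const * 2 powr (real n * (real CARD('d) + r * q - real J * (\<delta> * q)))"
        by (simp add: powr_add[symmetric] powr_realpow[symmetric] algebra_simps)
      also have "\<dots> \<le> real cube_const * ?x"
        using J by (intro mult_left_mono powr_mono) auto
      finally show ?thesis .
    qed
    ultimately show ?case
      using partition_sum_le_slices[of n \<delta> q J] elim(2) g q by (simp add: distrib_right)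
  qed
  then have "Lq_spectrum \<nu> q \<le> ereal (r * q - g)"
    using cube_const_pos by (intro Lq_spectrum_leI[of "real J + real cube_const"]) auto
  also have "\<dots> < ereal (r * q)" using g by simp
  finally show False using crit_le[OF q(3)] q(2) by linarith
qed

lemma upper_coarse_dim_eq: "upper_coarse_dim r \<nu> = ereal crit"
  using upper_coarse_dim_le_crit crit_le_upper_coarse_dim by (rule antisym)

section \<open>Regularity of the spectrum bounds the lower coarse dimension\<close>

text \<open>A Chernoff bound: masses below \<open>lo\<close> are compared at the exponent
  \<open>q - \<delta>\<close>, masses above \<open>hi\<close> at \<open>q + \<delta>\<close>. The
  remaining cubes are counted by the coarse count and have mass at most \<open>hi\<close>.\<close>

lemma partition_sum_le_middle:
  assumes "0 < q" "0 < \<delta>"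
  shows "partition_sum n q
    \<le> partition_sum n (q - \<delta>) * 2 powr (real n * (- (a + \<eta>) * \<delta>))
      + partition_sum n (q + \<delta>) * 2 powr (real n * ((a - \<eta>) * \<delta>))
      + real (card (coarse_cubes (a + \<eta> + r) n)) * 2 powr (real n * (- (a - \<eta>) * q))"
proof -
  define lo hi where "lo = 2 powr (- (a + \<eta>) * real n)" and "hi = 2 powr (- (a - \<eta>) * real n)"
  have pos: "lo > 0" "hi > 0" by (simp_all add: lo_def hi_def)
  have "prob C powr q \<le> prob C powr (q - \<delta>) * lo powr \<delta> + prob C powr (q + \<delta>) * hi powr (- \<delta>)
      + (if C \<in> coarse_cubes (a + \<eta> + r) n then hi powr q else 0)" (is "_ \<le> ?A + ?B + ?C")
    if C: "C \<in> pos_cubes n" for C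
  proof -
    have pC: "prob C > 0" using C by (rule pos_cubesD)
    have nn: "?A \<ge> 0" "?B \<ge> 0" "?C \<ge> 0" by auto
    consider "prob C < lo" | "prob C > hi" | "lo \<le> prob C" "prob C \<le> hi" by linarith
    then show ?thesis
    proof cases
      case 1
      have "prob C powr q = prob C powr (q - \<delta>) * prob C powr \<delta>"
        by (simp add: powr_add[symmetric])
      also have "\<dots> \<le> ?A" using 1 pC assms by (intro mult_left_mono powr_mono2) auto
      finally show ?thesis using nn by linarith
    next
      case 2
      have "prob C powr q = prob C powr (q + \<delta>) * prob C powr (- \<delta>)"
        by (simp add: powr_add[symmetric])
      also have "\<dots> \<le> ?B" using 2 pos assms by (intro mult_left_mono powr_mono2') auto
      finally show ?thesis using nn by linarith
    next
      case 3
      then have "C \<in> coarse_cubes (a + \<eta> + r) n"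
        using C by (simp add: coarse_cubes_def lo_def)
      moreover have "prob C powr q \<le> hi powr q" using 3 pC assms by (intro powr_mono2) auto
      ultimately have "prob C powr q \<le> ?C" by simp
      then show ?thesis using nn by linarith
    qed
  qed
  then have "partition_sum n q \<le> (\<Sum>C\<in>pos_cubes n.
      prob C powr (q - \<delta>) * lo powr \<delta> + prob C powr (q + \<delta>) * hi powr (- \<delta>)
      + (if C \<in> coarse_cubes (a + \<eta> + r) n then hi powr q else 0))"
    unfolding partition_sum_def by (intro sum_mono) blast
  also have "\<dots> = partition_sum n (q - \<delta>) * lo powr \<delta> + partition_sum n (q + \<delta>) * hi powr (- \<delta>)
      + real (card (coarse_cubes (a + \<eta> + r) n)) * hi powr q"
    using coarse_cubes_subset[of "a + \<eta> + r" n]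
    by (simp add: sum.distrib sum_distrib_right partition_sum_def sum.If_cases[OF pos_cubes_finite] Int_absorb1)
  also have "lo powr \<delta> = 2 powr (real n * (- (a + \<eta>) * \<delta>))"
    unfolding lo_def powr_powr by (rule arg_cong) (simp only: ac_simps)
  also have "hi powr (- \<delta>) = 2 powr (real n * ((a - \<eta>) * \<delta>))"
    unfolding hi_def powr_powr by (rule arg_cong) (simp add: algebra_simps)
  also have "hi powr q = 2 powr (real n * (- (a - \<eta>) * q))"
    unfolding hi_def powr_powr by (rule arg_cong) (simp only: ac_simps)
  finally show ?thesis .
qed

text \<open>A large deviation bound: if the second difference of the spectrum at \<open>q\<close> is small, then
  the cubes of mass about \<open>2 powr (- a * n)\<close>, where \<open>- a\<close> is the slope at \<open>q\<close>, carry at least half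
  of the partition sum.\<close>

lemma lower_coarse_dim_ge:
  assumes q: "0 < \<delta>" "0 < q - \<delta>" "q + \<delta> < 1"
    and ge: "r * q \<le> spectrum q" and lim: "lower_Lq_spectrum \<nu> q = Lq_spectrum \<nu> q"
    and \<eta>: "\<eta> > 0" and diff: "spectrum (q + \<delta>) - 2 * spectrum q + spectrum (q - \<delta>) < \<eta> * \<delta>"
  shows "ereal (q - 3 * \<eta> / r) \<le> lower_coarse_dim r \<nu>"
proof -
  define b bp bm where "b = spectrum q" "bp = spectrum (q + \<delta>)" "bm = spectrum (q - \<delta>)"
  note b_defs = this
  \<comment> \<open>Minus the left difference quotient of the spectrum at \<open>q\<close>;
    \<open>g\<close> below is the slack in the bound on the second difference.\<close>
  define a where "a = (bm - b) / \<delta>"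
  have a: "a * \<delta> = bm - b" "a \<ge> 0"
    using q spectrum_antimono[of "q - \<delta>" q] by (auto simp: a_def b_defs)
  define g where "g = \<eta> * \<delta> - (bp - 2 * b + bm)"
  have g: "g > 0" using diff by (simp add: g_def b_defs)
  \<comment> \<open>The tails have exponents at most \<open>b + s - \<eta> * \<delta>\<close> and
    \<open>b + s - g\<close>, so both are at most \<open>b - 3 * s\<close>;
    \<open>s \<le> \<eta>\<close> serves the final estimate.\<close>
  define s where "s = min \<eta> (min (g / 4) (\<eta> * \<delta> / 4))"
  have s: "s > 0" "s \<le> \<eta>" "4 * s \<le> g" "4 * s \<le> \<eta> * \<delta>" using g \<eta> q by (auto simp: s_def)
  define \<alpha> where "\<alpha> = a + \<eta> + r"
  have \<alpha>: "\<alpha> \<ge> r" "\<alpha> > 0" using a \<eta> r_pos by (auto simp: \<alpha>_def)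
  have "ereal (b - s) < lower_Lq_spectrum \<nu> q" "Lq_spectrum \<nu> (q + \<delta>) < ereal (bp + s)"
    "Lq_spectrum \<nu> (q - \<delta>) < ereal (bm + s)"
    using q s by (auto simp: lim b_defs ereal_spectrum[symmetric])
  note ev = lower_Lq_spectrum_lessD[OF this(1)] Lq_spectrum_lessD[OF this(2)] Lq_spectrum_lessD[OF this(3)]
  \<comment> \<open>Eventually each tail is at most a quarter of
    \<open>2 powr (real n * (b - s))\<close>, leaving half of it to the middle cubes.\<close>
  have "((\<lambda>n. (1 / 2 powr (2 * s)) ^ n) \<longlongrightarrow> 0) sequentially"
    using s by (intro LIMSEQ_realpow_zero) (auto simp: gr_one_powr)
  then have small: "\<forall>\<^sub>F n in sequentially. (1 / 2 powr (2 * s)) ^ n < (1 / 4 :: real)"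
    by (rule order_tendstoD) simp
  have "\<forall>\<^sub>F n in sequentially. (1 / 2) * 2 powr (real n * (b - s + (a - \<eta>) * q))
      \<le> max 1 (real (card (coarse_cubes \<alpha> n)))"
    using ev small
  proof eventually_elim
    case (elim n)
    define x where "x = 2 powr (real n * (b - s))"
    have x: "x > 0" by (simp add: x_def)
    have quarter: "2 powr (real n * (b - s - 2 * s)) \<le> x / 4"
    proof -
      have "2 powr (real n * (b - s - 2 * s)) = x * (1 / 2 powr (2 * s)) ^ n"
        by (simp add: x_def power_divide powr_power powr_minus_divide[symmetric] powr_add[symmetric] algebra_simps)
      also have "\<dots> \<le> x * (1 / 4)" using elim(4) x by (intro mult_left_mono) auto
      finally show ?thesis by simp
    qed
    have "partition_sum n (q - \<delta>) * 2 powr (real n * (- (a + \<eta>) * \<delta>))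
        \<le> 2 powr (real n * (bm + s)) * 2 powr (real n * (- (a + \<eta>) * \<delta>))"
      using elim(3) by (intro mult_right_mono) auto
    also have "\<dots> = 2 powr (real n * (bm + s - a * \<delta> - \<eta> * \<delta>))"
      by (simp add: powr_add[symmetric] algebra_simps)
    also have "\<dots> \<le> 2 powr (real n * (b - s - 2 * s))"
      using s a by (intro powr_mono mult_left_mono) auto
    finally have 1: "partition_sum n (q - \<delta>) * 2 powr (real n * (- (a + \<eta>) * \<delta>)) \<le> x / 4"
      using quarter by linarith
    have "partition_sum n (q + \<delta>) * 2 powr (real n * ((a - \<eta>) * \<delta>))
        \<le> 2 powr (real n * (bp + s)) * 2 powr (real n * ((a - \<eta>) * \<delta>))"
      using elim(2) by (intro mult_right_mono) auto
    also have "\<dots> = 2 powr (real n * (bp + s + a * \<delta> - \<eta> * \<delta>))"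
      by (simp add: powr_add[symmetric] algebra_simps)
    also have "\<dots> \<le> 2 powr (real n * (b - s - 2 * s))"
      using s a by (intro powr_mono mult_left_mono) (auto simp: g_def)
    finally have 2: "partition_sum n (q + \<delta>) * 2 powr (real n * ((a - \<eta>) * \<delta>)) \<le> x / 4"
      using quarter by linarith
    have "x \<le> partition_sum n q" using elim(1) by (simp add: x_def)
    with 1 2 partition_sum_le_middle[of q \<delta> n a \<eta>] q
    have "x / 2 \<le> real (card (coarse_cubes \<alpha> n)) * 2 powr (real n * (- (a - \<eta>) * q))"
      by (simp add: \<alpha>_def)
    then have "x / 2 * 2 powr (real n * ((a - \<eta>) * q))
        \<le> (real (card (coarse_cubes \<alpha> n)) * 2 powr (real n * (- (a - \<eta>) * q))) * 2 powr (real n * ((a - \<eta>) * q))"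
      by (intro mult_right_mono) auto
    also have "\<dots> = real (card (coarse_cubes \<alpha> n)) * (2 powr (real n * (- (a - \<eta>) * q)) * 2 powr (real n * ((a - \<eta>) * q)))"
      by simp
    also have "2 powr (real n * (- (a - \<eta>) * q)) * 2 powr (real n * ((a - \<eta>) * q)) = (1::real)"
      by (simp add: powr_add[symmetric] algebra_simps)
    also have "x / 2 * 2 powr (real n * ((a - \<eta>) * q)) = (1 / 2) * 2 powr (real n * (b - s + (a - \<eta>) * q))"
      by (simp add: x_def powr_add[symmetric] algebra_simps)
    finally show ?case by simp
  qed
  then have low: "ereal (b - s + (a - \<eta>) * q) \<le> lower_coarse_dim_at r \<nu> \<alpha>"
    unfolding lower_coarse_dim_at_eq by (rule liminf_ln_growth_ge[rotated]) simp
  \<comment> \<open>The three \<open>\<eta>\<close> pay for \<open>s\<close> and for the two shifts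
    by \<open>\<eta>\<close>, in \<open>\<alpha>\<close> and in \<open>a - \<eta>\<close>; dividing
    by \<open>r\<close> is enough as \<open>\<alpha> \<ge> r\<close>.\<close>
  have "\<alpha> * (q - 3 * \<eta> / r) \<le> b - s + (a - \<eta>) * q"
  proof -
    have "3 * \<eta> = r * (3 * \<eta> / r)" using r_pos by simp
    also have "\<dots> \<le> \<alpha> * (3 * \<eta> / r)" using \<alpha> \<eta> r_pos by (intro mult_right_mono) auto
    finally have "3 * \<eta> \<le> \<alpha> * (3 * \<eta> / r)" .
    moreover have "\<eta> * q \<le> \<eta>" using q \<eta> by (intro mult_left_le) auto
    moreover have "\<alpha> * q = a * q + \<eta> * q + r * q" by (simp add: \<alpha>_def algebra_simps)
    ultimately show ?thesis
      using ge s unfolding b_defs[symmetric] right_diff_distrib left_diff_distrib by linarith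
  qed
  then have "ereal \<alpha> * ereal (q - 3 * \<eta> / r) \<le> ereal (b - s + (a - \<eta>) * q)" by simp
  also note low
  finally have "ereal (q - 3 * \<eta> / r) \<le> lower_coarse_dim_at r \<nu> \<alpha> / ereal \<alpha>"
    using \<alpha> by (subst ereal_le_divide_pos) auto
  also have "\<dots> \<le> lower_coarse_dim r \<nu>"
    unfolding lower_coarse_dim_def using \<alpha> by (intro SUP_upper) simp
  finally show ?thesis .
qed

text \<open>Either alternative supplies a point with small second difference: near
  \<open>crit\<close> on its left by monotonicity, or \<open>crit\<close> itself by
  differentiability.\<close>

lemma crit_le_lower_coarse_dim:
  assumes "Lq_regular r \<nu>" shows "ereal crit \<le> lower_coarse_dim r \<nu>"
proof (cases "crit = 0")
  case True
  then show ?thesis using lower_coarse_dim_nonneg by (simp add: zero_ereal_def)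
next
  case False
  then have crit: "0 < crit" "crit < 1" using crit_nonneg crit_less_1 by auto
  show ?thesis
  proof (rule ereal_le_epsilon2)
    fix e :: real assume e: "e > 0"
    define \<eta> where "\<eta> = r * e / 6"
    have \<eta>: "\<eta> > 0" "3 * \<eta> / r = e / 2" using e r_pos by (auto simp: \<eta>_def)
    from assms have "ereal (crit - e) \<le> lower_coarse_dim r \<nu>"
      unfolding Lq_regular_def
    proof (elim disjE exE conjE)
      fix \<epsilon> assume \<epsilon>: "\<epsilon> > 0" and reg: "\<forall>q\<in>{crit - \<epsilon><..<crit}. 0 \<le> q \<longrightarrow>
          Lq_spectrum \<nu> q = lower_Lq_spectrum \<nu> q \<and> \<bar>Lq_spectrum \<nu> q\<bar> \<noteq> \<infinity>"
      \<comment> \<open>The interval from \<open>crit - h / 2\<close> to \<open>crit - h / 4\<close>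
        is positive, strictly left of \<open>crit\<close> and inside the regular range. The loss
        there is at most \<open>e / 4\<close>, besides the \<open>e / 2\<close> from
        \<open>\<eta>\<close>.\<close>
      define h where "h = min (e / 2) (min \<epsilon> crit)"
      have h: "h > 0" "h \<le> e / 2" "h \<le> \<epsilon>" "h \<le> crit" using e \<epsilon> crit by (auto simp: h_def)
      obtain q \<delta> where q: "\<delta> > 0" "crit - h / 2 \<le> q - \<delta>" "q + \<delta> \<le> crit - h / 4"
        "spectrum (q + \<delta>) - 2 * spectrum q + spectrum (q - \<delta>) < \<eta> * \<delta>"
      proof (rule antimono_small_second_difference[of "crit - h / 2" "crit - h / 4" \<eta> spectrum])
        show "spectrum y \<le> spectrum x" if "crit - h / 2 \<le> x" "x \<le> y" "y \<le> crit - h / 4" for x y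
          using that h crit by (intro spectrum_antimono) auto
      qed (use h \<eta> in auto)
      have "ereal (q - 3 * \<eta> / r) \<le> lower_coarse_dim r \<nu>"
        using q h crit \<eta> reg by (intro lower_coarse_dim_ge[of \<delta>] spectrum_ge_of_less_crit) auto
      moreover have "crit - e \<le> q - 3 * \<eta> / r" using \<eta> q h by simp
      ultimately show ?thesis by (meson ereal_less_eq(3) order_trans)
    next
      assume reg: "Lq_spectrum \<nu> crit = lower_Lq_spectrum \<nu> crit"
        and diff: "(\<lambda>q. real_of_ereal (Lq_spectrum \<nu> q)) differentiable at crit within {0..}"
      \<comment> \<open>As \<open>crit > 0\<close>, differentiability within \<open>{0..}\<close> is
        two-sided.\<close>
      have "at crit within {0..} = at crit"
        using crit by (intro at_within_interior) auto
      then have "spectrum differentiable at crit" using diff by (simp add: spectrum_def[abs_def])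
      then obtain \<delta> where \<delta>: "\<delta> > 0" "\<delta> < min crit (1 - crit)"
        "spectrum (crit + \<delta>) - 2 * spectrum crit + spectrum (crit - \<delta>) < \<eta> * \<delta>"
        by (rule differentiable_small_second_difference[of spectrum crit \<eta> "min crit (1 - crit)"])
          (use \<eta> crit in auto)
      have "ereal (crit - 3 * \<eta> / r) \<le> lower_coarse_dim r \<nu>"
        using \<delta> \<eta> reg crit spectrum_crit by (intro lower_coarse_dim_ge[of \<delta>]) auto
      moreover have "crit - e \<le> crit - 3 * \<eta> / r" using \<eta> e by simp
      ultimately show ?thesis by (meson ereal_less_eq(3) order_trans)
    qed
    then show "ereal crit \<le> lower_coarse_dim r \<nu> + ereal e"
      by (cases "lower_coarse_dim r \<nu>") auto
  qed
qed

lemma Lq_regular_imp_MF_regular: "Lq_regular r \<nu> \<Longrightarrow> MF_regular r \<nu>"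
  unfolding MF_regular_def
  using crit_le_lower_coarse_dim lower_le_upper_coarse_dim upper_coarse_dim_eq by (metis antisym)

end

subsection \<open>Quantization error\<close>

text \<open>Constant factors in error bounds appear as the summand \<open>c\<close> and vanish in
  the limit, so a decay rate \<open>\<kappa>\<close> of the error gives the dimension
  \<open>1 / \<kappa>\<close>.\<close>

lemma tendsto_ln_ratio:
  assumes "\<kappa> > 0"
  shows "((\<lambda>m. ereal (ln (real m) / (\<kappa> * ln (real m) + c))) \<longlongrightarrow> ereal (1 / \<kappa>)) sequentially"
proof -
  have ln: "filterlim (\<lambda>m. ln (real m)) at_top sequentially"
    by (rule filterlim_compose[OF ln_at_top filterlim_real_sequentially])
  have "(\<lambda>m. 1 / (\<kappa> + c * inverse (ln (real m)))) \<longlonglongrightarrow> 1 / (\<kappa> + c * 0)"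
    using assms by (intro tendsto_intros tendsto_inverse_0_at_top ln) auto
  moreover have "\<forall>\<^sub>F m in sequentially. 1 / (\<kappa> + c * inverse (ln (real m))) = ln (real m) / (\<kappa> * ln (real m) + c)"
    using eventually_gt_at_top[of 1]
  proof eventually_elim
    case (elim m)
    then have "ln (real m) > 0" by simp
    then show ?case by (simp add: field_simps)
  qed
  ultimately have "(\<lambda>m. ln (real m) / (\<kappa> * ln (real m) + c)) \<longlonglongrightarrow> 1 / (\<kappa> + c * 0)"
    by (rule Lim_transform_eventually)
  then show ?thesis by simp
qed

lemma eventually_ln_linear_pos:
  assumes "\<kappa> > 0" shows "\<forall>\<^sub>F m in sequentially. 0 < \<kappa> * ln (real m) + c"
proof -
  have "filterlim (\<lambda>m. ln (real m)) at_top sequentially"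
    by (rule filterlim_compose[OF ln_at_top filterlim_real_sequentially])
  then have "\<forall>\<^sub>F m in sequentially. - c / \<kappa> < ln (real m)"
    by (simp add: filterlim_at_top_dense)
  then show ?thesis
    by eventually_elim (use assms in \<open>simp add: field_simps\<close>)
qed

context compactly_supported_prob
begin

text \<open>The distance is almost surely bounded, because the support is.\<close>

lemma integrable_infdist_powr:
  assumes "finite A" "A \<noteq> {}" "r > 0"
  shows "integrable \<nu> (\<lambda>x. infdist x A powr r)"
proof -
  obtain a where a: "a \<in> A" using assms(2) by blast
  show ?thesis
  proof (rule integrable_const_bound)
    show "AE x in \<nu>. norm (infdist x A powr r) \<le> (real radius + norm a) powr r"
      using AE_bounded
    proof eventually_elim
      case (elim x)
      have "infdist x A \<le> dist x a" by (rule infdist_le[OF a])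
      also have "\<dots> \<le> real radius + norm a"
        using elim norm_triangle_ineq4[of x a] by (simp add: dist_norm)
      finally show ?case using assms(3) infdist_nonneg[of x A] by (auto intro!: powr_mono2)
    qed
    have "(\<lambda>x. infdist x A) \<in> borel_measurable borel"
      by (intro borel_measurable_continuous_onI continuous_on_infdist continuous_on_id)
    then show "(\<lambda>x. infdist x A powr r) \<in> borel_measurable \<nu>" by measurable
  qed
qed

lemma quantization_error_le:
  assumes "finite A" "1 \<le> card A" "card A \<le> n" "(\<integral>x. infdist x A powr r \<partial>\<nu>) \<le> c" "r > 0"
  shows "quantization_error r \<nu> n \<le> c powr (1 / r)"
proof -
  have "quantization_error r \<nu> n \<le> (\<integral>x. infdist x A powr r \<partial>\<nu>) powr (1 / r)"
    unfolding quantization_error_def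
    using assms(1-3) by (intro cINF_lower bdd_belowI[of _ 0]) auto
  also have "\<dots> \<le> c powr (1 / r)"
    using assms(4,5) by (intro powr_mono2 integral_nonneg) auto
  finally show ?thesis .
qed

lemma quantization_error_ge:
  assumes "1 \<le> n" "0 \<le> c" "r > 0"
    and "\<And>A. finite A \<Longrightarrow> 1 \<le> card A \<Longrightarrow> card A \<le> n \<Longrightarrow> c \<le> (\<integral>x. infdist x A powr r \<partial>\<nu>)"
  shows "c powr (1 / r) \<le> quantization_error r \<nu> n"
  unfolding quantization_error_def
proof (rule cINF_greatest)
  have "{0 :: real^'d} \<in> {A. finite A \<and> 1 \<le> card A \<and> card A \<le> n}" using assms(1) by simp
  then show "{A :: (real^'d) set. finite A \<and> 1 \<le> card A \<and> card A \<le> n} \<noteq> {}" by blast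
next
  fix A :: "(real^'d) set" assume "A \<in> {A. finite A \<and> 1 \<le> card A \<and> card A \<le> n}"
  then show "c powr (1 / r) \<le> (\<integral>x. infdist x A powr r \<partial>\<nu>) powr (1 / r)"
    using assms by (intro powr_mono2) auto
qed

lemma quantization_error_nonneg: "1 \<le> n \<Longrightarrow> r > 0 \<Longrightarrow> 0 \<le> quantization_error r \<nu> n"
  using quantization_error_ge[of n 0 r] by simp

end

section \<open>Upper bound for the quantization dimensions\<close>

context quantization_setting
begin

text \<open>Up to a constant, the error integral over \<open>C\<close> when the nearest chosen point
  is at a distance comparable to the side of \<open>C\<close>.\<close>

definition weight :: "nat \<Rightarrow> (real^'d) set \<Rightarrow> real" where
  "weight n C = prob C * 2 powr (- r * real n)"

lemma weight_pos: "C \<in> pos_cubes n \<Longrightarrow> weight n C > 0"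
  by (auto simp: weight_def dest: pos_cubesD)

text \<open>The sums over single levels are eventually dominated by a geometric sequence of ratio
  \<open>2 powr (s - r * q) < 1\<close>; hence one bound for all levels together.\<close>

lemma sum_weight_powr_bounded:
  assumes "0 < q" "q < 1" "spectrum q < r * q"
  obtains S where "S > 0" "\<And>N. (\<Sum>n\<le>N. \<Sum>C\<in>pos_cubes n. weight n C powr q) \<le> S"
proof -
  obtain s where s: "spectrum q < s" "s < r * q" using dense assms(3) by blast
  have eq: "(\<Sum>C\<in>pos_cubes n. weight n C powr q) = 2 powr (real n * (- r * q)) * partition_sum n q" for n
    by (simp add: weight_def partition_sum_def powr_mult powr_powr sum_distrib_right ac_simps)
  have "Lq_spectrum \<nu> q < ereal s" using s assms by (simp add: ereal_spectrum[symmetric])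
  from Lq_spectrum_lessD[OF this]
  have ev: "\<forall>\<^sub>F n in sequentially. norm (\<Sum>C\<in>pos_cubes n. weight n C powr q) \<le> (2 powr (s - r * q)) ^ n"
  proof eventually_elim
    case (elim n)
    have "(\<Sum>C\<in>pos_cubes n. weight n C powr q) \<le> 2 powr (real n * (- r * q)) * 2 powr (real n * s)"
      unfolding eq using elim by (intro mult_left_mono) auto
    also have "\<dots> = (2 powr (s - r * q)) ^ n"
      by (simp add: powr_add[symmetric] powr_power algebra_simps)
    finally show ?case by (simp add: sum_nonneg)
  qed
  have "(2::real) powr (s - r * q) < 2 powr 0" using s by (intro powr_less_mono) auto
  then have "summable (\<lambda>n. (2 powr (s - r * q)) ^ n)" by (intro summable_geometric) auto
  then have "summable (\<lambda>n. \<Sum>C\<in>pos_cubes n. weight n C powr q)"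
    using ev by (rule summable_comparison_test_ev[rotated])
  then have le: "(\<Sum>n\<le>N. \<Sum>C\<in>pos_cubes n. weight n C powr q) \<le> (\<Sum>n. \<Sum>C\<in>pos_cubes n. weight n C powr q)" for N
    by (intro sum_le_suminf) (auto intro!: sum_nonneg)
  then have "0 \<le> (\<Sum>n. \<Sum>C\<in>pos_cubes n. weight n C powr q)"
    by (rule order_trans[rotated]) (auto intro!: sum_nonneg)
  then show ?thesis
    using le by (intro that[of "(\<Sum>n. \<Sum>C\<in>pos_cubes n. weight n C powr q) + 1"]) (auto intro: add_increasing2)
qed

definition centre :: "(real^'d) set \<Rightarrow> real^'d" where
  "centre C = (SOME x. x \<in> C)"

lemma centre_in: "x \<in> C \<Longrightarrow> centre C \<in> C"
  unfolding centre_def by (rule someI)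

definition heavy_cubes :: "real \<Rightarrow> nat \<Rightarrow> (real^'d) set set" where
  "heavy_cubes t n = {C \<in> pos_cubes n. t \<le> weight n C}"

text \<open>Cutting at level \<open>N\<close> keeps the set finite; the unit cubes provide a point
  nearby for those \<open>x\<close> that lie in no heavy cube.\<close>

definition centres :: "real \<Rightarrow> nat \<Rightarrow> (real^'d) set" where
  "centres t N = centre ` ((\<Union>n\<le>N. heavy_cubes t n) \<union> pos_cubes 0)"

lemma finite_heavy_cubes: "finite (heavy_cubes t n)"
  using pos_cubes_finite by (auto simp: heavy_cubes_def)

lemma finite_centres: "finite (centres t N)"
  by (auto simp: centres_def finite_heavy_cubes pos_cubes_finite)

lemma centres_nonempty: "centres t N \<noteq> {}"
  using pos_cubes_nonempty[of 0] by (simp add: centres_def)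

text \<open>Markov's inequality for the weights at each level, summed over the levels.\<close>

lemma card_centres_le:
  assumes "t > 0" "q > 0" "(\<Sum>n\<le>N. \<Sum>C\<in>pos_cubes n. weight n C powr q) \<le> S"
  shows "real (card (centres t N)) \<le> S * t powr (- q) + real (card (pos_cubes 0))"
proof -
  have "real (card (heavy_cubes t n)) * t powr q \<le> (\<Sum>C\<in>pos_cubes n. weight n C powr q)" for n
  proof -
    have "real (card (heavy_cubes t n)) * t powr q = (\<Sum>C\<in>heavy_cubes t n. t powr q)" by simp
    also have "\<dots> \<le> (\<Sum>C\<in>heavy_cubes t n. weight n C powr q)"
      using assms by (intro sum_mono powr_mono2) (auto simp: heavy_cubes_def)
    also have "\<dots> \<le> (\<Sum>C\<in>pos_cubes n. weight n C powr q)"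
      by (intro sum_mono2 pos_cubes_finite) (auto simp: heavy_cubes_def)
    finally show ?thesis .
  qed
  then have "(\<Sum>n\<le>N. real (card (heavy_cubes t n)) * t powr q) \<le> (\<Sum>n\<le>N. \<Sum>C\<in>pos_cubes n. weight n C powr q)"
    by (intro sum_mono)
  also note assms(3)
  finally have "(\<Sum>n\<le>N. real (card (heavy_cubes t n))) * t powr q \<le> S"
    by (simp add: sum_distrib_right)
  then have "(\<Sum>n\<le>N. real (card (heavy_cubes t n))) \<le> S * t powr (- q)"
    using assms(1) by (simp add: powr_minus field_simps)
  moreover have "card (centres t N) \<le> (\<Sum>n\<le>N. card (heavy_cubes t n)) + card (pos_cubes 0)"
  proof -
    have "card (centres t N) \<le> card ((\<Union>n\<le>N. heavy_cubes t n) \<union> pos_cubes 0)"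
      unfolding centres_def by (intro card_image_le) (auto simp: finite_heavy_cubes pos_cubes_finite)
    also have "\<dots> \<le> card (\<Union>n\<le>N. heavy_cubes t n) + card (pos_cubes 0)" by (rule card_Un_le)
    also have "card (\<Union>n\<le>N. heavy_cubes t n) \<le> (\<Sum>n\<le>N. card (heavy_cubes t n))"
      by (rule card_UN_le) simp
    finally show ?thesis by simp
  qed
  then have "real (card (centres t N)) \<le> (\<Sum>n\<le>N. real (card (heavy_cubes t n))) + real (card (pos_cubes 0))"
    by (simp flip: of_nat_sum of_nat_add)
  ultimately show ?thesis by linarith
qed

text \<open>The first non-heavy cube around \<open>x\<close> is either of level \<open>0\<close> or contained in a heavy cube of
  twice its size.\<close>

lemma infdist_centres_le:
  assumes pos: "\<And>n. dyadic_cube n (dyadic_index n x) \<in> pos_cubes n" and N: "2 powr (- r * real N) < t"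
  shows "infdist x (centres t N) powr r \<le> (2 * real CARD('d)) powr r *
    (\<Sum>n\<le>N. \<Sum>C\<in>pos_cubes n - heavy_cubes t n. 2 powr (- r * real n) * indicator C x)"
proof -
  define Q where "Q n = dyadic_cube n (dyadic_index n x)" for n
  have Q: "Q n \<in> pos_cubes n" "x \<in> Q n" for n using pos by (auto simp: Q_def mem_dyadic_cube_iff)
  \<comment> \<open>At level \<open>N\<close> every cube is light, so the first light level around
    \<open>x\<close> exists and is at most \<open>N\<close>.\<close>
  have "weight N (Q N) \<le> 2 powr (- r * real N)" by (simp add: weight_def mult_le_cancel_right1)
  then have exN: "weight N (Q N) < t" using N by linarith
  define n where "n = (LEAST n. weight n (Q n) < t)"
  have n: "weight n (Q n) < t" "n \<le> N"
    unfolding n_def using exN by (auto intro: LeastI Least_le)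
  \<comment> \<open>The factor \<open>2\<close> accounts for the heavy cube one level up, where
    \<open>2 ^ n = 2 * 2 ^ m\<close>.\<close>
  have "infdist x (centres t N) \<le> 2 * real CARD('d) / 2 ^ n"
  proof (cases n)
    case 0
    have "centre (Q 0) \<in> centres t N" using Q by (auto simp: centres_def)
    then have "infdist x (centres t N) \<le> dist x (centre (Q 0))" by (rule infdist_le)
    also have "\<dots> \<le> real CARD('d) / 2 ^ 0"
      using Q[of 0] by (intro dist_dyadic_cube_le[of "Q 0"]) (auto intro: centre_in pos_cubesD)
    finally show ?thesis using 0 by simp
  next
    case (Suc m)
    have "\<not> weight m (Q m) < t" unfolding n_def[symmetric]
      by (rule not_less_Least) (use Suc n_def in simp)
    then have "Q m \<in> heavy_cubes t m" using Q by (simp add: heavy_cubes_def)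
    then have "centre (Q m) \<in> centres t N" 
      unfolding centres_def using Suc n(2) by (intro imageI UnI1 UN_I[of m]) auto
    then have "infdist x (centres t N) \<le> dist x (centre (Q m))" by (rule infdist_le)
    also have "\<dots> \<le> real CARD('d) / 2 ^ m"
      using Q[of m] by (intro dist_dyadic_cube_le[of "Q m"]) (auto intro: centre_in pos_cubesD)
    finally show ?thesis using Suc by simp
  qed
  then have "infdist x (centres t N) powr r \<le> (2 * real CARD('d) / 2 ^ n) powr r"
    using r_pos by (intro powr_mono2 infdist_nonneg) auto
  also have "\<dots> = (2 * real CARD('d)) powr r * 2 powr (- r * real n)"
    by (simp add: powr_divide powr_realpow[symmetric] powr_powr powr_minus_divide mult.commute)
  also have "2 powr (- r * real n) \<le> (\<Sum>C\<in>pos_cubes n - heavy_cubes t n. 2 powr (- r * real n) * indicator C x)"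
  proof -
    have "Q n \<in> pos_cubes n - heavy_cubes t n" using Q n(1) by (auto simp: heavy_cubes_def)
    from member_le_sum[OF this, of "\<lambda>C. 2 powr (- r * real n) * indicator C x"]
    show ?thesis using Q(2)[of n] pos_cubes_finite by simp
  qed
  also have "\<dots> \<le> (\<Sum>n\<le>N. \<Sum>C\<in>pos_cubes n - heavy_cubes t n. 2 powr (- r * real n) * indicator C x)"
    using n(2) by (intro member_le_sum[of n]) (auto intro!: sum_nonneg)
  finally show ?thesis by (simp add: mult_left_mono)
qed

text \<open>Integrating the pointwise bound leaves the weights of the light cubes. These are below
  \<open>t\<close>, so each weight is at most \<open>t powr (1 - q)\<close> times its
  \<open>q\<close>-th power.\<close>

lemma integral_infdist_centres_le:
  assumes N: "2 powr (- r * real N) < t" and q: "0 < q" "q < 1" and "t > 0"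
    and S: "(\<Sum>n\<le>N. \<Sum>C\<in>pos_cubes n. weight n C powr q) \<le> S"
  shows "(\<integral>x. infdist x (centres t N) powr r \<partial>\<nu>) \<le> (2 * real CARD('d)) powr r * S * t powr (1 - q)"
proof -
  let ?K = "(2 * real CARD('d)) powr r"
  let ?g = "\<lambda>x. ?K * (\<Sum>n\<le>N. \<Sum>C\<in>pos_cubes n - heavy_cubes t n. 2 powr (- r * real n) * indicator C x)"
  have int: "integrable \<nu> (\<lambda>x. 2 powr (- r * real n) * indicator C x)"
    if "C \<in> pos_cubes n - heavy_cubes t n" for n C
    using that by (intro integrable_mult_right integrable_real_indicator) (auto simp: emeasure_eq_measure)
  have "(\<integral>x. infdist x (centres t N) powr r \<partial>\<nu>) \<le> (\<integral>x. ?g x \<partial>\<nu>)"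
  proof (rule integral_mono_AE)
    show "integrable \<nu> (\<lambda>x. infdist x (centres t N) powr r)"
      by (intro integrable_infdist_powr finite_centres centres_nonempty r_pos)
    show "integrable \<nu> ?g"
      by (intro integrable_mult_right Bochner_Integration.integrable_sum int)
    show "AE x in \<nu>. infdist x (centres t N) powr r \<le> ?g x"
      using AE_in_pos_cubes by eventually_elim (intro infdist_centres_le N, blast)
  qed
  also have "\<dots> = ?K * (\<Sum>n\<le>N. \<Sum>C\<in>pos_cubes n - heavy_cubes t n. \<integral>x. 2 powr (- r * real n) * indicator C x \<partial>\<nu>)"
  proof -
    have "integrable \<nu> (\<lambda>x. \<Sum>C\<in>pos_cubes n - heavy_cubes t n. 2 powr (- r * real n) * indicator C x)" for n
      by (intro Bochner_Integration.integrable_sum int)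
    then have outer: "(\<integral>x. ?g x \<partial>\<nu>)
        = ?K * (\<Sum>n\<le>N. \<integral>x. (\<Sum>C\<in>pos_cubes n - heavy_cubes t n. 2 powr (- r * real n) * indicator C x) \<partial>\<nu>)"
      unfolding integral_mult_right_zero by (subst Bochner_Integration.integral_sum) auto
    have inner: "(\<integral>x. (\<Sum>C\<in>pos_cubes n - heavy_cubes t n. 2 powr (- r * real n) * indicator C x) \<partial>\<nu>)
        = (\<Sum>C\<in>pos_cubes n - heavy_cubes t n. \<integral>x. 2 powr (- r * real n) * indicator C x \<partial>\<nu>)" for n
      by (intro Bochner_Integration.integral_sum int)
    show ?thesis unfolding outer inner ..
  qed
  also have "(\<Sum>n\<le>N. \<Sum>C\<in>pos_cubes n - heavy_cubes t n. \<integral>x. 2 powr (- r * real n) * indicator C x \<partial>\<nu>)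
      = (\<Sum>n\<le>N. \<Sum>C\<in>pos_cubes n - heavy_cubes t n. weight n C)"
    by (intro sum.cong refl) (auto simp: weight_def)
  also have "\<dots> \<le> (\<Sum>n\<le>N. \<Sum>C\<in>pos_cubes n - heavy_cubes t n. t powr (1 - q) * weight n C powr q)"
  proof (intro sum_mono)
    fix n C assume C: "C \<in> pos_cubes n - heavy_cubes t n"
    then have w: "0 < weight n C" "weight n C < t" by (auto simp: heavy_cubes_def weight_pos)
    have "weight n C = weight n C powr (1 - q) * weight n C powr q"
      using w by (simp add: powr_add[symmetric])
    also have "\<dots> \<le> t powr (1 - q) * weight n C powr q"
      using w q by (intro mult_right_mono powr_mono2) auto
    finally show "weight n C \<le> t powr (1 - q) * weight n C powr q" .
  qed
  also have "\<dots> \<le> (\<Sum>n\<le>N. \<Sum>C\<in>pos_cubes n. t powr (1 - q) * weight n C powr q)"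
    by (intro sum_mono sum_mono2 pos_cubes_finite) auto
  also have "\<dots> = t powr (1 - q) * (\<Sum>n\<le>N. \<Sum>C\<in>pos_cubes n. weight n C powr q)"
    by (simp add: sum_distrib_left)
  also have "\<dots> \<le> t powr (1 - q) * S" using S by (intro mult_left_mono) auto
  finally show ?thesis by (simp add: ac_simps mult_left_mono)
qed

lemma quantization_error_upper_bound:
  assumes q: "0 < q" "q < 1" "spectrum q < r * q"
  obtains c1 c2 where "c1 > 0" "c2 > 0"
    "\<And>t m. 0 < t \<Longrightarrow> t \<le> 1 \<Longrightarrow> c1 * t powr (- q) \<le> real m \<Longrightarrow>
       quantization_error r \<nu> m \<le> c2 * t powr ((1 - q) / r)"
proof -
  obtain S where S: "S > 0" "\<And>N. (\<Sum>n\<le>N. \<Sum>C\<in>pos_cubes n. weight n C powr q) \<le> S"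
    using sum_weight_powr_bounded[OF q] by blast
  let ?K = "(2 * real CARD('d)) powr r"
  have K: "?K > 0" by simp
  show ?thesis
  proof (rule that[of "S + real (card (pos_cubes 0))" "(?K * S) powr (1 / r)"])
    fix t :: real and m :: nat
    assume t: "0 < t" "t \<le> 1" and m: "(S + real (card (pos_cubes 0))) * t powr (- q) \<le> real m"
    \<comment> \<open>The cut-off \<open>N\<close> depends on \<open>t\<close>, which is harmless
      because \<open>S\<close> bounds the sums for all \<open>N\<close>.\<close>
    have "((\<lambda>N. (2 powr (- r)) ^ N) \<longlongrightarrow> 0) sequentially"
      using r_pos by (intro LIMSEQ_realpow_zero) (auto simp: powr_less_one)
    from order_tendstoD(2)[OF this t(1)] obtain N where "(2 powr (- r)) ^ N < t"
      by (auto simp: eventually_sequentially)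
    then have N: "2 powr (- r * real N) < t" by (simp add: powr_power mult.commute)
    \<comment> \<open>This absorbs the fixed number of unit cubes into the constant factor.\<close>
    have "1 \<le> t powr (- q)" using t q by (simp add: powr_minus one_le_inverse_iff powr_le1)
    then have "real (card (pos_cubes 0)) \<le> real (card (pos_cubes 0)) * t powr (- q)"
      by (simp add: mult_le_cancel_left1)
    with card_centres_le[OF t(1) q(1) S(2), of N] m have "card (centres t N) \<le> m"
      by (simp add: distrib_right)
    moreover have "1 \<le> card (centres t N)"
      using finite_centres[of t N] centres_nonempty[of t N] by (simp add: Suc_le_eq card_gt_0_iff)
    ultimately have "quantization_error r \<nu> m \<le> (?K * S * t powr (1 - q)) powr (1 / r)"
      using integral_infdist_centres_le[OF N q(1,2) t(1) S(2)] r_pos finite_centres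
      by (intro quantization_error_le)
    also have "\<dots> = (?K * S) powr (1 / r) * t powr ((1 - q) / r)"
      using K S t by (simp add: powr_mult powr_powr)
    finally show "quantization_error r \<nu> m \<le> (?K * S) powr (1 / r) * t powr ((1 - q) / r)" .
  qed (use S K in \<open>auto simp: add_pos_nonneg\<close>)
qed

text \<open>The logarithm is used only for nonzero error; error \<open>0\<close> is the case in
  which \<open>quantization_quotient\<close> is \<open>0\<close>.\<close>

lemma ln_quantization_error_le:
  assumes q: "0 < q" "q < 1" "spectrum q < r * q"
  obtains c where "\<forall>\<^sub>F m in sequentially. 0 \<le> quantization_error r \<nu> m \<and>
    (quantization_error r \<nu> m \<noteq> 0 \<longrightarrow>
      (1 - q) / (r * q) * ln (real m) + c \<le> - ln (quantization_error r \<nu> m))"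
proof -
  obtain c1 c2 where c: "c1 > 0" "c2 > 0"
    "\<And>t m. 0 < t \<Longrightarrow> t \<le> 1 \<Longrightarrow> c1 * t powr (- q) \<le> real m \<Longrightarrow>
       quantization_error r \<nu> m \<le> c2 * t powr ((1 - q) / r)"
    using quantization_error_upper_bound[OF q] by blast
  have "\<forall>\<^sub>F m in sequentially. c1 \<le> real m"
    using filterlim_real_sequentially by (simp add: filterlim_at_top)
  then have "\<forall>\<^sub>F m in sequentially. 0 \<le> quantization_error r \<nu> m \<and>
    (quantization_error r \<nu> m \<noteq> 0 \<longrightarrow>
      (1 - q) / (r * q) * ln (real m) + (- ln c2 - (1 - q) / (r * q) * ln c1) \<le> - ln (quantization_error r \<nu> m))"
    using eventually_gt_at_top[of 0]
  proof eventually_elim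
    case (elim m)
    \<comment> \<open>The solution of \<open>c1 * t powr (- q) = real m\<close>, which spends all
      \<open>m\<close> points; \<open>t \<le> 1\<close> once \<open>m \<ge> c1\<close>.\<close>
    define t where "t = (real m / c1) powr (- (1 / q))"
    have "1 \<le> real m / c1" using elim c(1) by simp
    then have "t \<le> 1" "t > 0" "t powr (- q) = real m / c1"
      using q elim c(1) powr_mono[of "- (1 / q)" 0 "real m / c1"] by (auto simp: t_def powr_powr)
    then have le: "quantization_error r \<nu> m \<le> c2 * t powr ((1 - q) / r)"
      using c by (intro c(3)) auto
    have nn: "0 \<le> quantization_error r \<nu> m" using elim r_pos by (intro quantization_error_nonneg) auto
    have "(1 - q) / (r * q) * ln (real m) + (- ln c2 - (1 - q) / (r * q) * ln c1) \<le> - ln (quantization_error r \<nu> m)"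
      if "quantization_error r \<nu> m \<noteq> 0"
    proof -
      have "ln (quantization_error r \<nu> m) \<le> ln (c2 * t powr ((1 - q) / r))"
        using le nn that by simp
      also have "\<dots> = ln c2 + (1 - q) / r * ln t"
        using c \<open>t > 0\<close> by (simp add: ln_mult ln_powr)
      also have "ln t = - (1 / q) * (ln (real m) - ln c1)"
        using elim c by (simp add: t_def ln_powr ln_div)
      also have "(1 - q) / r * (- (1 / q) * (ln (real m) - ln c1)) = - ((1 - q) / (r * q) * (ln (real m) - ln c1))"
        by simp
      finally show ?thesis unfolding right_diff_distrib by linarith
    qed
    then show ?case using nn by blast
  qed
  then show ?thesis by (rule that)
qed

lemma upper_quantization_dim_le:
  assumes q: "0 < q" "q < 1" "spectrum q < r * q"
  shows "upper_quantization_dim r \<nu> \<le> ereal (r * q / (1 - q))"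
    and "0 \<le> lower_quantization_dim r \<nu>"
proof -
  define \<kappa> where "\<kappa> = (1 - q) / (r * q)"
  have \<kappa>: "\<kappa> > 0" using q r_pos by (simp add: \<kappa>_def)
  obtain c where c: "\<forall>\<^sub>F m in sequentially. 0 \<le> quantization_error r \<nu> m \<and>
    (quantization_error r \<nu> m \<noteq> 0 \<longrightarrow> \<kappa> * ln (real m) + c \<le> - ln (quantization_error r \<nu> m))"
    using ln_quantization_error_le[OF q] unfolding \<kappa>_def by blast
  have ev: "\<forall>\<^sub>F m in sequentially. 0 \<le> quantization_quotient r \<nu> m \<and>
      quantization_quotient r \<nu> m \<le> ln (real m) / (\<kappa> * ln (real m) + c)"
    using c eventually_ln_linear_pos[OF \<kappa>, of c] eventually_gt_at_top[of 0]
  proof eventually_elim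
    case (elim m)
    show ?case
    proof (cases "quantization_error r \<nu> m = 0")
      case False
      then have le: "\<kappa> * ln (real m) + c \<le> - ln (quantization_error r \<nu> m)" using elim(1) by blast
      have "0 \<le> ln (real m)" using elim by simp
      then have "0 \<le> ln (real m) / (- ln (quantization_error r \<nu> m))"
        "ln (real m) / (- ln (quantization_error r \<nu> m)) \<le> ln (real m) / (\<kappa> * ln (real m) + c)"
        using le elim(2) by (intro divide_nonneg_pos divide_left_mono mult_pos_pos; linarith)+
      then show ?thesis using False by (simp add: quantization_quotient_def)
    qed (use elim in \<open>simp add: quantization_quotient_def\<close>)
  qed
  have "upper_quantization_dim r \<nu> \<le> limsup (\<lambda>m. ereal (ln (real m) / (\<kappa> * ln (real m) + c)))"
    unfolding upper_quantization_dim_def by (intro Limsup_mono eventually_mono[OF ev]) auto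
  also have "\<dots> = ereal (1 / \<kappa>)" by (intro lim_imp_Limsup tendsto_ln_ratio \<kappa>) simp
  finally show "upper_quantization_dim r \<nu> \<le> ereal (r * q / (1 - q))" by (simp add: \<kappa>_def)
  show "0 \<le> lower_quantization_dim r \<nu>"
    unfolding lower_quantization_dim_def by (intro Liminf_bounded eventually_mono[OF ev]) auto
qed

lemma upper_quantization_dim_le_crit: "upper_quantization_dim r \<nu> \<le> ereal (r * crit / (1 - crit))"
proof (rule tendsto_lowerbound)
  have "((\<lambda>q. r * q / (1 - q)) \<longlongrightarrow> r * crit / (1 - crit)) (at_right crit)"
    using crit_less_1 by (intro tendsto_intros) auto
  then show "((\<lambda>q. ereal (r * q / (1 - q))) \<longlongrightarrow> ereal (r * crit / (1 - crit))) (at_right crit)"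
    by simp
  show "\<forall>\<^sub>F q in at_right crit. upper_quantization_dim r \<nu> \<le> ereal (r * q / (1 - q))"
    using eventually_at_right_real[OF crit_less_1]
  proof eventually_elim
    case (elim q)
    \<comment> \<open>The strict inequality is available at some \<open>p < q\<close>, not
      necessarily at \<open>q\<close>; the bound is increasing in the exponent.\<close>
    then obtain p where p: "crit \<le> p" "p < q" "p > 0" "p < 1" "spectrum p < r * p"
      using crit_approx[of q] by auto
    have "r * p / (1 - p) \<le> r * q / (1 - q)"
      using p elim r_pos by (intro frac_le mult_left_mono) auto
    then show ?case using upper_quantization_dim_le(1)[OF p(3-5)]
      by (meson ereal_less_eq(3) order_trans)
  qed
qed simp

lemma lower_quantization_dim_nonneg: "0 \<le> lower_quantization_dim r \<nu>"
proof -
  obtain p where "p > 0" "p < 1" "spectrum p < r * p" using crit_approx[OF crit_less_1] by blast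
  then show ?thesis by (rule upper_quantization_dim_le(2))
qed

section \<open>Lower bound for the quantization dimensions\<close>

text \<open>The set of at most \<open>m\<close> points is near at most
  \<open>4 ^ CARD('d) * m\<close> cubes, so at least half of the coarse cubes stay free. A free cube
  is at distance at least \<open>1 / 2 ^ n\<close> from all points and contributes at least its
  weight.\<close>

lemma quantization_error_lower_bound:
  assumes m: "1 \<le> m" and card: "2 * 4 ^ CARD('d) * real m \<le> real (card (coarse_cubes \<alpha> n))"
  shows "(real (card (coarse_cubes \<alpha> n)) / 2 * 2 powr (- \<alpha> * real n)) powr (1 / r) \<le> quantization_error r \<nu> m"
proof (rule quantization_error_ge[OF m _ r_pos])
  fix A :: "(real^'d) set" assume A: "finite A" "1 \<le> card A" "card A \<le> m"
  then have ne: "A \<noteq> {}" by auto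
  define near where "near y = {C \<in> dyadic_cubes n. \<exists>x\<in>C. dist x y < 1 / 2 ^ n}" for y :: "real^'d"
  have near: "finite (near y)" "card (near y) \<le> 4 ^ CARD('d)" for y
    unfolding near_def by (rule dyadic_cubes_near_point)+
  define free where "free = coarse_cubes \<alpha> n - (\<Union>y\<in>A. near y)"
  have free: "finite free" "free \<subseteq> pos_cubes n"
    unfolding free_def using coarse_cubes_finite[of \<alpha> n] coarse_cubes_subset[of \<alpha> n] by blast+
  have "real (card (\<Union>y\<in>A. near y)) \<le> 4 ^ CARD('d) * real m"
  proof -
    have "card (\<Union>y\<in>A. near y) \<le> (\<Sum>y\<in>A. card (near y))" by (rule card_UN_le[OF A(1)])
    also have "\<dots> \<le> (\<Sum>y\<in>A. 4 ^ CARD('d))" by (intro sum_mono near)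
    also have "\<dots> \<le> m * 4 ^ CARD('d)" using A(3) by simp
    finally have "real (card (\<Union>y\<in>A. near y)) \<le> real (m * 4 ^ CARD('d))" by (rule of_nat_mono)
    then show ?thesis by (simp add: mult.commute)
  qed
  moreover have "real (card (coarse_cubes \<alpha> n)) \<le> real (card free) + real (card (\<Union>y\<in>A. near y))"
    using diff_card_le_card_Diff[of "\<Union>y\<in>A. near y" "coarse_cubes \<alpha> n"] A(1) near(1)
    unfolding free_def by simp
  ultimately have card_free: "real (card (coarse_cubes \<alpha> n)) / 2 \<le> real (card free)"
    using card by linarith
  have "real (card (coarse_cubes \<alpha> n)) / 2 * 2 powr (- \<alpha> * real n) \<le> (\<Sum>C\<in>free. 2 powr (- \<alpha> * real n))"
    using card_free by (simp add: mult_right_mono)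
  also have "\<dots> \<le> (\<Sum>C\<in>free. weight n C)"
  proof (rule sum_mono)
    fix C assume "C \<in> free"
    then have "2 powr ((r - \<alpha>) * real n) * 2 powr (- r * real n) \<le> weight n C"
      unfolding weight_def by (intro mult_right_mono) (auto simp: free_def coarse_cubes_def)
    then show "2 powr (- \<alpha> * real n) \<le> weight n C"
      by (simp add: powr_add[symmetric] algebra_simps)
  qed
  also have "\<dots> = (\<Sum>C\<in>free. \<integral>x. 2 powr (- r * real n) * indicator C x \<partial>\<nu>)"
    using free by (intro sum.cong) (auto simp: weight_def)
  also have "\<dots> = (\<integral>x. (\<Sum>C\<in>free. 2 powr (- r * real n) * indicator C x) \<partial>\<nu>)"
    using free(2)
    by (intro Bochner_Integration.integral_sum[symmetric] integrable_mult_right integrable_real_indicator)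
       (auto simp: emeasure_eq_measure)
  also have "\<dots> \<le> (\<integral>x. infdist x A powr r \<partial>\<nu>)"
  proof (rule integral_mono)
    show "integrable \<nu> (\<lambda>x. \<Sum>C\<in>free. 2 powr (- r * real n) * indicator C x)"
      using free(2)
      by (intro Bochner_Integration.integrable_sum integrable_mult_right integrable_real_indicator)
         (auto simp: emeasure_eq_measure)
    show "integrable \<nu> (\<lambda>x. infdist x A powr r)"
      by (intro integrable_infdist_powr A ne r_pos)
    fix x :: "real^'d"
    show "(\<Sum>C\<in>free. 2 powr (- r * real n) * indicator C x) \<le> infdist x A powr r"
    proof (cases "\<exists>C\<in>free. x \<in> C")
      case False
      then have "(\<Sum>C\<in>free. 2 powr (- r * real n) * indicator C x) = (0 :: real)"
        by (intro sum.neutral) auto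
      then show ?thesis by simp
    next
      case True
      then obtain C where C: "C \<in> free" "x \<in> C" by blast
      have unique: "C' = C" if "C' \<in> free" "x \<in> C'" for C'
      proof -
        have "C \<in> dyadic_cubes n" "C' \<in> dyadic_cubes n"
          using that(1) C(1) free(2) pos_cubesD(1) by blast+
        then show ?thesis using dyadic_cubes_unique that(2) C(2) by metis
      qed
      \<comment> \<open>The cubes of one level are disjoint, so only the summand of \<open>C\<close>
        survives.\<close>
      have "(\<Sum>C'\<in>free. 2 powr (- r * real n) * indicator C' x)
          = (\<Sum>C'\<in>free. if C' = C then 2 powr (- r * real n) else (0::real))"
      proof (rule sum.cong[OF refl])
        fix C' assume "C' \<in> free"
        then have "x \<in> C' \<longleftrightarrow> C' = C" using unique C(2) by metis
        then show "2 powr (- r * real n) * indicator C' x = (if C' = C then 2 powr (- r * real n) else (0::real))"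
          using C(2) by auto
      qed
      also have "\<dots> = (1 / 2 ^ n) powr r"
        using C free(1) by (simp add: powr_divide powr_realpow[symmetric] powr_powr powr_minus_divide mult.commute)
      also have "\<dots> \<le> infdist x A powr r"
      proof (intro powr_mono2)
        have "1 / 2 ^ n \<le> dist x y" if "y \<in> A" for y
        proof (rule ccontr)
          assume "\<not> ?thesis"
          moreover have "C \<in> dyadic_cubes n" using C(1) free(2) pos_cubesD(1) by blast
          ultimately have "C \<in> near y" using C(2) by (auto simp: near_def not_le)
          then show False using C(1) that by (auto simp: free_def)
        qed
        then show "1 / 2 ^ n \<le> infdist x A"
          unfolding infdist_notempty[OF ne] by (intro cINF_greatest ne)
      qed (use r_pos in auto)
      finally show ?thesis .
    qed
  qed
  finally show "real (card (coarse_cubes \<alpha> n)) / 2 * 2 powr (- \<alpha> * real n) \<le> (\<integral>x. infdist x A powr r \<partial>\<nu>)" .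
qed simp

text \<open>For given \<open>m\<close> the level \<open>n\<close> is the first at which the coarse
  count is guaranteed to reach \<open>L * m\<close>; the previous lemma then gives an error of order
  \<open>2 powr (- (real n * \<alpha> * (1 - f)) / r)\<close>.\<close>

lemma ln_quantization_error_ge:
  assumes f: "0 < f" "f < 1" "ereal f < lower_coarse_dim r \<nu>"
  obtains c where "\<forall>\<^sub>F m in sequentially. 0 < quantization_error r \<nu> m \<and>
      - ln (quantization_error r \<nu> m) \<le> (1 - f) / (r * f) * ln (real m) + c"
proof -
  obtain \<alpha> where \<alpha>: "\<alpha> > 0" "ereal f < lower_coarse_dim_at r \<nu> \<alpha> / ereal \<alpha>"
    using f(3) unfolding lower_coarse_dim_def less_SUP_iff by auto
  then have "ereal (\<alpha> * f) < lower_coarse_dim_at r \<nu> \<alpha>"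
    by (subst (asm) ereal_less_divide_pos) auto
  then have "\<forall>\<^sub>F n in sequentially. 2 powr (real n * (\<alpha> * f)) \<le> max 1 (real (card (coarse_cubes \<alpha> n)))"
    unfolding lower_coarse_dim_at_eq by (rule liminf_ln_growth_lessD) simp
  then obtain n0 where n0: "\<And>n. n0 \<le> n \<Longrightarrow> 2 powr (real n * (\<alpha> * f)) \<le> max 1 (real (card (coarse_cubes \<alpha> n)))"
    by (auto simp: eventually_sequentially)
  define L :: real where "L = 2 * 4 ^ CARD('d)"
  have L: "L \<ge> 1" using one_le_power[of "4::real" "CARD('d)"] unfolding L_def by linarith
  \<comment> \<open>It collects the factor \<open>1 / 2\<close> of the error bound, the factor
    \<open>L\<close>, and the rounding of the level to an integer.\<close>
  define c where "c = 1 / r * (ln 2 + (1 - f) * (ln L / f + \<alpha> * ln 2))"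
  have af: "\<alpha> * f > 0" using \<alpha> f by simp
  have "\<forall>\<^sub>F m in sequentially. 2 powr (real (Suc n0) * (\<alpha> * f)) \<le> real m"
    using filterlim_real_sequentially by (simp add: filterlim_at_top)
  then have "\<forall>\<^sub>F m in sequentially. 0 < quantization_error r \<nu> m \<and>
      - ln (quantization_error r \<nu> m) \<le> (1 - f) / (r * f) * ln (real m) + c"
    using eventually_ge_at_top[of 1]
  proof eventually_elim
    case (elim m)
    have m: "real m \<ge> 1" using elim(2) by simp
    have Lm: "real m \<le> L * real m" "L * real m > 0" using L m by (auto simp: mult_le_cancel_right1)
    \<comment> \<open>The real level at which
      \<open>2 powr (u * \<alpha> * f) = L * real m\<close>.\<close>
    define u where "u = log 2 (L * real m) / (\<alpha> * f)"
    have "real (Suc n0) * (\<alpha> * f) \<le> log 2 (L * real m)"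
      using elim(1) Lm by (subst le_log_iff) auto
    then have u: "real (Suc n0) \<le> u" using af by (simp add: u_def pos_le_divide_eq)
    define n where "n = nat \<lceil>u\<rceil>"
    have n: "u \<le> real n" "real n \<le> u + 1" using u unfolding n_def by linarith+
    have "n0 \<le> n" "0 < n" using n(1) u by linarith+
    \<comment> \<open>A value above \<open>1\<close> shows that the truncated count is the count
      itself.\<close>
    have "1 < 2 powr (real n * (\<alpha> * f))" using af \<open>0 < n\<close> by (intro gr_one_powr) auto
    then have count: "2 powr (real n * (\<alpha> * f)) \<le> real (card (coarse_cubes \<alpha> n))"
      using n0[OF \<open>n0 \<le> n\<close>] by linarith
    have "log 2 (L * real m) \<le> real n * (\<alpha> * f)"
      using n(1) af by (simp add: u_def pos_divide_le_eq)
    then have "L * real m \<le> 2 powr (real n * (\<alpha> * f))"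
      using Lm by (subst (asm) log_le_iff) auto
    with count have "(real (card (coarse_cubes \<alpha> n)) / 2 * 2 powr (- \<alpha> * real n)) powr (1 / r) \<le> quantization_error r \<nu> m"
      using elim(2) by (intro quantization_error_lower_bound) (auto simp: L_def)
    moreover have "(1 / 2 * 2 powr (- (real n * (\<alpha> * (1 - f))))) powr (1 / r)
        \<le> (real (card (coarse_cubes \<alpha> n)) / 2 * 2 powr (- \<alpha> * real n)) powr (1 / r)"
    proof (rule powr_mono2)
      have "1 / 2 * 2 powr (- (real n * (\<alpha> * (1 - f)))) = 2 powr (real n * (\<alpha> * f)) / 2 * 2 powr (- \<alpha> * real n)"
        by (simp add: powr_add[symmetric] algebra_simps)
      also have "\<dots> \<le> real (card (coarse_cubes \<alpha> n)) / 2 * 2 powr (- \<alpha> * real n)"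
        using count by (intro mult_right_mono) auto
      finally show "1 / 2 * 2 powr (- (real n * (\<alpha> * (1 - f)))) \<le> real (card (coarse_cubes \<alpha> n)) / 2 * 2 powr (- \<alpha> * real n)" .
    qed (use r_pos in auto)
    ultimately have le: "(1 / 2 * 2 powr (- (real n * (\<alpha> * (1 - f))))) powr (1 / r) \<le> quantization_error r \<nu> m"
      by linarith
    have pos: "0 < (1 / 2 * 2 powr (- (real n * (\<alpha> * (1 - f))))) powr (1 / r)" by simp
    have qpos: "0 < quantization_error r \<nu> m" using pos le by (rule less_le_trans)
    have "- ln (quantization_error r \<nu> m) \<le> - ln ((1 / 2 * 2 powr (- (real n * (\<alpha> * (1 - f))))) powr (1 / r))"
      using le pos qpos by (subst neg_le_iff_le) (rule ln_mono)
    also have "\<dots> = 1 / r * (ln 2 + (1 - f) * (real n * \<alpha> * ln 2))"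
      by (simp add: ln_powr ln_mult ln_div algebra_simps)
    also have "real n * \<alpha> * ln 2 \<le> (u + 1) * \<alpha> * ln 2"
      using n(2) \<alpha>(1) by (intro mult_right_mono) auto
    also have "(u + 1) * \<alpha> * ln 2 = (ln (real m) + ln L) / f + \<alpha> * ln 2"
      using \<alpha>(1) f L m by (simp add: u_def log_def ln_mult field_simps)
    also have "1 / r * (ln 2 + (1 - f) * ((ln (real m) + ln L) / f + \<alpha> * ln 2)) = (1 - f) / (r * f) * ln (real m) + c"
      using f(1) r_pos by (simp add: c_def field_simps)
    finally show ?case using qpos f r_pos by (simp add: mult_left_mono divide_right_mono)
  qed
  then show ?thesis by (rule that)
qed

lemma lower_quantization_dim_ge:
  assumes f: "0 < f" "f < 1" "ereal f < lower_coarse_dim r \<nu>"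
  shows "ereal (r * f / (1 - f)) \<le> lower_quantization_dim r \<nu>"
proof -
  define \<kappa> where "\<kappa> = (1 - f) / (r * f)"
  have \<kappa>: "\<kappa> > 0" using f r_pos by (simp add: \<kappa>_def)
  obtain c where c: "\<forall>\<^sub>F m in sequentially. 0 < quantization_error r \<nu> m \<and>
      - ln (quantization_error r \<nu> m) \<le> \<kappa> * ln (real m) + c"
    using ln_quantization_error_ge[OF f] unfolding \<kappa>_def by blast
  \<comment> \<open>The upper bound on the error enters only to make \<open>- ln\<close> of the
    error eventually positive, as comparing the quotients requires.\<close>
  obtain q where q: "0 < q" "q < 1" "spectrum q < r * q"
    using crit_approx[OF crit_less_1] by blast
  then have \<kappa>': "(1 - q) / (r * q) > 0" using r_pos by simp
  obtain c' where c': "\<forall>\<^sub>F m in sequentially. 0 \<le> quantization_error r \<nu> m \<and>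
    (quantization_error r \<nu> m \<noteq> 0 \<longrightarrow>
      (1 - q) / (r * q) * ln (real m) + c' \<le> - ln (quantization_error r \<nu> m))"
    using ln_quantization_error_le[OF q] by blast
  have "\<forall>\<^sub>F m in sequentially. ln (real m) / (\<kappa> * ln (real m) + c) \<le> quantization_quotient r \<nu> m"
    using c c' eventually_ln_linear_pos[OF \<kappa>', of c'] eventually_gt_at_top[of 0]
  proof eventually_elim
    case (elim m)
    have "quantization_error r \<nu> m \<noteq> 0" using elim(1) by simp
    then have "(1 - q) / (r * q) * ln (real m) + c' \<le> - ln (quantization_error r \<nu> m)"
      using elim(2) by blast
    then have "0 < - ln (quantization_error r \<nu> m)" using elim(3) by linarith
    moreover have "0 \<le> ln (real m)" using elim(4) by simp
    ultimately have "ln (real m) / (\<kappa> * ln (real m) + c) \<le> ln (real m) / (- ln (quantization_error r \<nu> m))"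
      using elim(1) by (intro divide_left_mono mult_pos_pos; linarith)
    then show ?case using elim(1) by (simp add: quantization_quotient_def)
  qed
  then have "liminf (\<lambda>m. ereal (ln (real m) / (\<kappa> * ln (real m) + c))) \<le> lower_quantization_dim r \<nu>"
    unfolding lower_quantization_dim_def by (intro Liminf_mono) (auto elim: eventually_mono)
  moreover have "liminf (\<lambda>m. ereal (ln (real m) / (\<kappa> * ln (real m) + c))) = ereal (1 / \<kappa>)"
    by (intro lim_imp_Liminf tendsto_ln_ratio \<kappa>) simp
  ultimately show ?thesis by (simp add: \<kappa>_def)
qed

section \<open>The common value of the dimensions under multifractal regularity\<close>

text \<open>Regularity turns the lower coarse dimension into \<open>crit\<close>, so every positive
  \<open>f < crit\<close> is admissible; let \<open>f\<close> tend to \<open>crit\<close>.\<close>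

lemma crit_le_lower_quantization_dim:
  assumes "MF_regular r \<nu>"
  shows "ereal (r * crit / (1 - crit)) \<le> lower_quantization_dim r \<nu>"
proof (cases "crit = 0")
  case True
  then show ?thesis using lower_quantization_dim_nonneg by (simp add: zero_ereal_def)
next
  case False
  then have crit: "0 < crit" using crit_nonneg by simp
  show ?thesis
  proof (rule tendsto_upperbound)
    have "((\<lambda>f. r * f / (1 - f)) \<longlongrightarrow> r * crit / (1 - crit)) (at_left crit)"
      using crit_less_1 by (intro tendsto_intros) auto
    then show "((\<lambda>f. ereal (r * f / (1 - f))) \<longlongrightarrow> ereal (r * crit / (1 - crit))) (at_left crit)"
      by simp
    show "\<forall>\<^sub>F f in at_left crit. ereal (r * f / (1 - f)) \<le> lower_quantization_dim r \<nu>"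
      using eventually_at_left_real[OF crit]
    proof eventually_elim
      case (elim f)
      then show ?case
        using crit_less_1 assms upper_coarse_dim_eq
        by (intro lower_quantization_dim_ge) (auto simp: MF_regular_def)
    qed
  qed simp
qed

lemma MF_regular_imp_quantization_dim:
  assumes "MF_regular r \<nu>"
  shows "lower_quantization_dim r \<nu> = ereal (r * crit / (1 - crit))"
    and "upper_quantization_dim r \<nu> = ereal (r * crit / (1 - crit))"
proof -
  have "lower_quantization_dim r \<nu> \<le> upper_quantization_dim r \<nu>"
    unfolding lower_quantization_dim_def upper_quantization_dim_def by (rule Liminf_le_Limsup) simp
  with crit_le_lower_quantization_dim[OF assms] upper_quantization_dim_le_crit
  show "lower_quantization_dim r \<nu> = ereal (r * crit / (1 - crit))"
    "upper_quantization_dim r \<nu> = ereal (r * crit / (1 - crit))"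
    by (auto intro!: antisym)
qed

text \<open>Since \<open>crit < 1\<close>, the quotient clause of the definition applies; its
  numerator is \<open>r * crit\<close> by \<open>spectrum_crit\<close> or, at
  \<open>crit = 0\<close>, by assumption.\<close>

lemma upper_Renyi_dim_crit:
  assumes "crit = 0 \<longrightarrow> Lq_spectrum \<nu> 0 = 0"
  shows "upper_Renyi_dim \<nu> crit = ereal (r * crit / (1 - crit))"
proof -
  have "Lq_spectrum \<nu> crit = ereal (r * crit)"
  proof (cases "crit = 0")
    case False
    then show ?thesis
      using spectrum_crit crit_nonneg crit_less_1 by (simp add: ereal_spectrum[symmetric])
  qed (use assms in simp)
  then show ?thesis using crit_less_1 by (simp add: upper_Renyi_dim_def)
qed

end

text \<open>The proviso in the last conjunct concerns a jump of the spectrum at \<open>0\<close>. If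
  the critical exponent is \<open>0\<close>, regularity makes both quantization dimensions
  \<open>0\<close>, while \<open>upper_Renyi_dim \<nu> 0\<close> is
  \<open>Lq_spectrum \<nu> 0\<close>; equality then means exactly the proviso.\<close>

theorem theorem1p11:
  fixes \<nu> :: "(real^'d) measure" and r :: real
  assumes "prob_space \<nu>" and "sets \<nu> = sets borel"
    and "compact (topological_support \<nu>)"
    and "r > 0"
  shows "(Lq_regular r \<nu> \<longrightarrow> MF_regular r \<nu>)
    \<and> (MF_regular r \<nu> \<longrightarrow>
         lower_quantization_dim r \<nu> = upper_quantization_dim r \<nu>
         \<and> ((critical_q \<nu> r = 0 \<longrightarrow> Lq_spectrum \<nu> 0 = 0) \<longrightarrow>
              upper_quantization_dim r \<nu> = upper_Renyi_dim \<nu> (critical_q \<nu> r)))"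
proof -
  interpret prob_space \<nu> by (rule assms(1))
  interpret quantization_setting \<nu> r
    by unfold_locales (use assms in auto)
  show ?thesis
    using Lq_regular_imp_MF_regular MF_regular_imp_quantization_dim upper_Renyi_dim_crit by simp
qed

end
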